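(* Let $I$ be a monomial ideal in the polynomial ring $B=k[x_1,\dots,x_n]$ and $S^\bullet=B/I$. Let $J_m=(x_i\mid i\in N)\subset B$, where $N=\{i\in\{1,\dots,n\}\mid\partial_{x_i}\notin T_B(I)\}$, let $R=B/J_m$, and let $\mathfrak g_R=R\otimes_BT_B(I)$. Put $G_{J_m}(S)^i=J_m^iS/J_m^{i+1}S$. Then the Hilbert series $$H_{Lie}(S^\bullet,t)=\sum_{i\ge 0}\ell_{\mathfrak g_R}\big(G_{J_m}(S)^i\big)t^i$$ is a rational function of $t$.
   Context: $k$ is an algebraically closed field of characteristic $0$. $T_B$ is the $B$-module of $k$-linear derivations of $B$ and $T_B(I)=\{\delta\in T_B\mid\delta(I)\subset I\}$, which is a Lie algebroid over $B$ (a $B$-submodule of $T_B$ closed under the Lie bracket). A monomial ideal is an ideal generated by monomials $x^\alpha=x_1^{\alpha_1}\cdots x_n^{\alpha_n}$. The ideal $J_m$ is preserved by $T_B(I)$ (it is the maximal defining ideal of the $T_B(I)$-module $B$), so $\mathfrak g_R=R\otimes_BT_B(I)=T_B(I)/J_mT_B(I)$ is a Lie algebroid over $R\cong k[x_i]_{i\notin N}$, mapping to the derivations $T_R$ of $R$. Each $G_{J_m}(S)^i$ is an $R$-module on which $T_B(I)$ acts $k$-linearly by the induced action and this makes it a $\mathfrak g_R$-module. $\ell_{\mathfrak g_R}$ is the length as $\mathfrak g_R$-module (length of a composition series by $R$-submodules stable under $\mathfrak g_R$). *)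

theory Defs
  imports
    "HOL-Algebra.Algebra"
    "HOL-Algebra.Algebraic_Closure_Type"
    "HOL-Library.Poly_Mapping"
    "HOL-Library.Extended_Nat"
    "HOL-Computational_Algebra.Polynomial_FPS"
begin

section \<open>Polynomial ring, monomial ideals, derivations\<close>

text \<open>The variables are indexed by a finite type \<open>'n\<close>; exponents are finitely supported
  functions from \<open>'n\<close> to the naturals, and the multiplication of \<^type>\<open>poly_mapping\<close> is
  convolution. The ring is also used as a structure in the sense of \<open>HOL-Algebra\<close>.\<close>

type_synonym ('n, 'k) mpoly = "('n \<Rightarrow>\<^sub>0 nat) \<Rightarrow>\<^sub>0 'k"

abbreviation B_ring :: "('n::finite, 'k::field) mpoly ring" where
  "B_ring \<equiv> ring_of_type_algebra"

definition xmono :: "('n::finite \<Rightarrow>\<^sub>0 nat) \<Rightarrow> ('n, 'k::field) mpoly" where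
  "xmono \<alpha> = Poly_Mapping.single \<alpha> 1"

definition const :: "'k::field \<Rightarrow> ('n::finite, 'k) mpoly" where
  "const c = Poly_Mapping.single 0 c"

definition var :: "'n::finite \<Rightarrow> ('n, 'k::field) mpoly" where
  "var i = xmono (Poly_Mapping.single i 1)"

definition monomial_ideal :: "('n::finite, 'k::field) mpoly set \<Rightarrow> bool" where
  "monomial_ideal I \<longleftrightarrow> (\<exists>A. I = Idl\<^bsub>B_ring\<^esub> (xmono ` A))"

text \<open>The truncated difference of exponents is harmless: where it truncates, the
  coefficient vanishes.\<close>

definition partial :: "'n::finite \<Rightarrow> ('n, 'k::field) mpoly \<Rightarrow> ('n, 'k) mpoly" where
  "partial i f = (\<Sum>\<alpha>\<in>Poly_Mapping.keys f.
     Poly_Mapping.single (\<alpha> - Poly_Mapping.single i 1)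
       (of_nat (Poly_Mapping.lookup \<alpha> i) * Poly_Mapping.lookup f \<alpha>))"

definition derivations :: "(('n::finite, 'k::field) mpoly \<Rightarrow> ('n, 'k) mpoly) set" where
  "derivations = {\<delta>. (\<forall>f g. \<delta> (f + g) = \<delta> f + \<delta> g) \<and>
                      (\<forall>c f. \<delta> (const c * f) = const c * \<delta> f) \<and>
                      (\<forall>f g. \<delta> (f * g) = \<delta> f * g + f * \<delta> g)}"

definition T_B :: "('n::finite, 'k::field) mpoly set \<Rightarrow> (('n, 'k) mpoly \<Rightarrow> ('n, 'k) mpoly) set" where
  "T_B I = {\<delta> \<in> derivations. \<delta> ` I \<subseteq> I}"


section \<open>Module constructions\<close>

text \<open>The fields \<^const>\<open>monoid.mult\<close> and \<^const>\<open>monoid.one\<close> of the \<open>module\<close> record play no role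
  for modules and are left unspecified below.\<close>

text \<open>\<open>ideal_smult M J\<close> is the submodule \<open>J M\<close>, in the style of \<^const>\<open>ideal_prod\<close>.\<close>

inductive_set ideal_smult :: "('a, 'b) module \<Rightarrow> 'a set \<Rightarrow> 'b set"
  for M :: "('a, 'b) module" and J :: "'a set" where
    smult: "\<lbrakk> a \<in> J; m \<in> carrier M \<rbrakk> \<Longrightarrow> a \<odot>\<^bsub>M\<^esub> m \<in> ideal_smult M J"
  | add: "\<lbrakk> x \<in> ideal_smult M J; y \<in> ideal_smult M J \<rbrakk> \<Longrightarrow> x \<oplus>\<^bsub>M\<^esub> y \<in> ideal_smult M J"

primrec ideal_pow :: "('a, 'b) ring_scheme \<Rightarrow> 'a set \<Rightarrow> nat \<Rightarrow> 'a set" where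
  "ideal_pow R J 0 = carrier R"
| "ideal_pow R J (Suc i) = ideal_prod R J (ideal_pow R J i)"

text \<open>The quotient \<open>M / K\<close> of an \<open>R\<close>-module by a submodule \<open>K\<close> containing \<open>J M\<close>, as a module
  over \<open>R Quot J\<close>. Scalars are cosets of \<open>J\<close>, and scalar multiplication is defined as
  multiplication is in \<^const>\<open>FactRing\<close> (cf. \<^const>\<open>rcoset_mult\<close>).\<close>

definition quot_module :: "('a, 'b) module \<Rightarrow> 'b set \<Rightarrow> ('a set, 'b set) module" where
  "quot_module M K =
     \<lparr> carrier = a_rcosets\<^bsub>M\<^esub> K, monoid.mult = undefined, monoid.one = undefined,
       ring.zero = K, ring.add = set_add M,
       module.smult = (\<lambda>r c. \<Union>a\<in>r. \<Union>m\<in>c. K +>\<^bsub>M\<^esub> (a \<odot>\<^bsub>M\<^esub> m)) \<rparr>"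


section \<open>Composition series and length\<close>

text \<open>\<open>A\<close> is a set of operators acting on the \<open>R\<close>-module \<open>M\<close> by \<open>act\<close>.\<close>

definition stable_submodule ::
    "('a, 'r) ring_scheme \<Rightarrow> 'd set \<Rightarrow> ('d \<Rightarrow> 'b \<Rightarrow> 'b) \<Rightarrow> ('a, 'b) module \<Rightarrow> 'b set \<Rightarrow> bool" where
  "stable_submodule R A act M H \<longleftrightarrow>
     submodule H R M \<and> (\<forall>d\<in>A. \<forall>x\<in>H. act d x \<in> H)"

definition composition_series ::
    "('a, 'r) ring_scheme \<Rightarrow> 'd set \<Rightarrow> ('d \<Rightarrow> 'b \<Rightarrow> 'b) \<Rightarrow> ('a, 'b) module \<Rightarrow> 'b set list \<Rightarrow> bool" where
  "composition_series R A act M Hs \<longleftrightarrow>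
     Hs \<noteq> [] \<and> hd Hs = {\<zero>\<^bsub>M\<^esub>} \<and> last Hs = carrier M \<and>
     (\<forall>H\<in>set Hs. stable_submodule R A act M H) \<and>
     (\<forall>j. Suc j < length Hs \<longrightarrow>
        Hs ! j \<subset> Hs ! Suc j \<and>
        \<not> (\<exists>H. stable_submodule R A act M H \<and> Hs ! j \<subset> H \<and> H \<subset> Hs ! Suc j))"

text \<open>The infimum of the empty set is \<open>\<infinity>\<close>, so the length is infinite when there is no
  composition series; otherwise all composition series have the same length.\<close>

definition module_length ::
    "('a, 'r) ring_scheme \<Rightarrow> 'd set \<Rightarrow> ('d \<Rightarrow> 'b \<Rightarrow> 'b) \<Rightarrow> ('a, 'b) module \<Rightarrow> enat" where
  "module_length R A act M =
     Inf {enat l | l. \<exists>Hs. composition_series R A act M Hs \<and> length Hs = Suc l}"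


section \<open>The Lie algebroid and the graded module\<close>

definition N_set :: "('n::finite, 'k::field) mpoly set \<Rightarrow> 'n set" where
  "N_set I = {i. partial i \<notin> T_B I}"

definition J_m :: "('n::finite, 'k::field) mpoly set \<Rightarrow> ('n, 'k) mpoly set" where
  "J_m I = Idl\<^bsub>B_ring\<^esub> (var ` N_set I)"

definition R_ring :: "('n::finite, 'k::field) mpoly set \<Rightarrow> ('n, 'k) mpoly set ring" where
  "R_ring I = B_ring Quot J_m I"

definition T_B_module :: "('n::finite, 'k::field) mpoly set
    \<Rightarrow> (('n, 'k) mpoly, ('n, 'k) mpoly \<Rightarrow> ('n, 'k) mpoly) module" where
  "T_B_module I =
     \<lparr> carrier = T_B I, monoid.mult = undefined, monoid.one = undefined,
       ring.zero = (\<lambda>g. 0), ring.add = (\<lambda>\<delta> \<epsilon> g. \<delta> g + \<epsilon> g),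
       module.smult = (\<lambda>f \<delta> g. f * \<delta> g) \<rparr>"

text \<open>\<open>R \<otimes>\<^sub>B T_B(I)\<close>, realised as \<open>T_B(I) / J_m T_B(I)\<close>. Of its Lie algebroid structure, the
  length below involves only its underlying set and its action.\<close>

definition g_R :: "('n::finite, 'k::field) mpoly set
    \<Rightarrow> (('n, 'k) mpoly set, (('n, 'k) mpoly \<Rightarrow> ('n, 'k) mpoly) set) module" where
  "g_R I = quot_module (T_B_module I) (ideal_smult (T_B_module I) (J_m I))"

definition S_module :: "('n::finite, 'k::field) mpoly set
    \<Rightarrow> (('n, 'k) mpoly, ('n, 'k) mpoly set) module" where
  "S_module I = (let S = B_ring Quot I in
     \<lparr> carrier = carrier S, monoid.mult = monoid.mult S, monoid.one = monoid.one S,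
       ring.zero = ring.zero S, ring.add = ring.add S,
       module.smult = (\<lambda>f s. (I +>\<^bsub>B_ring\<^esub> f) \<otimes>\<^bsub>S\<^esub> s) \<rparr>)"

definition JS :: "('n::finite, 'k::field) mpoly set \<Rightarrow> nat \<Rightarrow> ('n, 'k) mpoly set set" where
  "JS I i = ideal_smult (S_module I) (ideal_pow B_ring (J_m I) i)"

definition G_module :: "('n::finite, 'k::field) mpoly set \<Rightarrow> nat
    \<Rightarrow> (('n, 'k) mpoly set, ('n, 'k) mpoly set set) module" where
  "G_module I i = quot_module (S_module I \<lparr> carrier := JS I i \<rparr>) (JS I (Suc i))"

text \<open>The actions induced by a derivation \<open>\<delta> \<in> T_B(I)\<close> on \<open>S\<close> and on \<open>G\<^sup>i\<close>, and the resulting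
  action of a class \<open>a \<in> \<gg>\<^sub>R\<close>. Each is given on a coset as the union of the classes of the
  values at its representatives, which all coincide.\<close>

definition act_S :: "('n::finite, 'k::field) mpoly set
    \<Rightarrow> (('n, 'k) mpoly \<Rightarrow> ('n, 'k) mpoly) \<Rightarrow> ('n, 'k) mpoly set \<Rightarrow> ('n, 'k) mpoly set" where
  "act_S I \<delta> s = (\<Union>f\<in>s. I +>\<^bsub>B_ring\<^esub> \<delta> f)"

definition act_G :: "('n::finite, 'k::field) mpoly set \<Rightarrow> nat
    \<Rightarrow> (('n, 'k) mpoly \<Rightarrow> ('n, 'k) mpoly) \<Rightarrow> ('n, 'k) mpoly set set \<Rightarrow> ('n, 'k) mpoly set set" where
  "act_G I i \<delta> c = (\<Union>s\<in>c. JS I (Suc i) +>\<^bsub>S_module I\<^esub> act_S I \<delta> s)"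

definition act_g_R :: "('n::finite, 'k::field) mpoly set \<Rightarrow> nat
    \<Rightarrow> (('n, 'k) mpoly \<Rightarrow> ('n, 'k) mpoly) set \<Rightarrow> ('n, 'k) mpoly set set \<Rightarrow> ('n, 'k) mpoly set set" where
  "act_g_R I i a c = (\<Union>\<delta>\<in>a. act_G I i \<delta> c)"

definition Lie_length :: "('n::finite, 'k::field) mpoly set \<Rightarrow> nat \<Rightarrow> enat" where
  "Lie_length I i = module_length (R_ring I) (carrier (g_R I)) (act_g_R I i) (G_module I i)"


section \<open>Hilbert series\<close>

text \<open>\<^const>\<open>the_enat\<close> is meaningful only for finite lengths.\<close>

definition H_Lie :: "('n::finite, 'k::field) mpoly set \<Rightarrow> rat fps" where
  "H_Lie I = Abs_fps (\<lambda>i. of_nat (the_enat (Lie_length I i)))"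

definition rational_fps :: "'a::field fps \<Rightarrow> bool" where
  "rational_fps F \<longleftrightarrow> (\<exists>p q. q \<noteq> 0 \<and> fps_of_poly q * F = fps_of_poly p)"

end

theory Submission
  imports Defs
begin

text \<open>Let \<open>E\<close> be the set of exponents of the monomials in \<open>I\<close>; it is closed under adding exponents. The
length of \<open>G\<^sup>i\<close> can be computed exactly, and turns out to be the number of monomials of degree \<open>i\<close>
outside \<open>E\<close> in a polynomial ring with possibly fewer variables. The Hilbert series is therefore that of the
complement of an upward closed set of exponents, which is rational.

A submodule of \<open>G\<^sup>i\<close> stable under the Lie algebroid is the same as an ideal \<open>K\<close> of \<open>B\<close> that is stable
under \<open>T\<^sub>B(I)\<close> and lies between \<open>J\<^sup>i\<^sup>+\<^sup>1 + I\<close> and \<open>J\<^sup>i + I\<close>. The Euler derivations \<open>x\<^sub>j \<partial>\<^sub>j\<close> all preserve \<open>I\<close>, and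
in characteristic \<open>0\<close> their joint eigenspaces in \<open>B\<close> are spanned by single monomials; so \<open>K\<close> is spanned
by monomials (\<open>torus_stable_monomial\<close>). Stability then only involves the derivations \<open>x\<^sup>\<mu> \<partial>\<^sub>j\<close> that occur
in \<open>T\<^sub>B(I)\<close> (\<open>T_B_exponent\<close>). Modulo \<open>J\<^sup>i\<^sup>+\<^sup>1 + I\<close> these act on exponents in two ways: \<open>\<partial>\<^sub>j\<close> with \<open>j \<notin> N\<close>
removes a factor \<open>x\<^sub>j\<close>, and \<open>x\<^sub>l \<partial>\<^sub>j\<close> replaces a factor \<open>x\<^sub>j\<close> by \<open>x\<^sub>l\<close> (\<open>admissible_shift\<close>). The relation
``\<open>x\<^sub>l \<partial>\<^sub>j\<close> preserves \<open>I\<close>'' is a preorder on the variables; collecting the exponents of \<open>x\<^sub>j\<close>, \<open>j \<in> N\<close>, over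
each of its equivalence classes gives the class degree \<open>\<gamma>\<close> of a monomial. Exponent sets of stable ideals
are unions of fibres of \<open>\<gamma>\<close> (\<open>admissible_saturated\<close>), and for any two of them \<open>U \<subset> U'\<close> some single fibre
of \<open>U'\<close> may be added to \<open>U\<close> without leaving the family (\<open>admissible_step\<close>): the strict replacements
increase a weight, so a fibre of largest weight will do. Hence every composition series of \<open>G\<^sup>i\<close> has as
many steps as there are class degrees of total degree \<open>i\<close> outside \<open>E\<close> (\<open>module_length_eq_card\<close>,
\<open>Lie_length_eq\<close>).

Rationality of the counting series is by induction on the number of variables
(\<open>rational_complement_series\<close>). Splitting off the exponents not involving a variable \<open>x\<^sub>c\<close> expresses the
series of \<open>E\<close> through a series with one variable less and the series of \<open>{\<alpha>. \<alpha> + e\<^sub>c \<in> E}\<close>. The ascending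
chain of these shifted sets becomes constant by Dickson's lemma, and for the constant set the relation
reads \<open>F = G + t F\<close>.\<close>

section \<open>Length of a module from an order embedding\<close>

text \<open>The family of stable submodules is described by an order embedding \<open>supp\<close> into the subsets of a finite
set, in which inclusions can be refined by steps adding a single point. Then every composition series has
exactly one step for each point, so that no appeal to the Jordan--Hoelder theorem is needed.\<close>

lemma module_length_eq_card:
  fixes supp :: "'b set \<Rightarrow> 'x set"
  assumes fin: "finite Z"
    and zero: "stable_submodule R A act M {\<zero>\<^bsub>M\<^esub>}" "supp {\<zero>\<^bsub>M\<^esub>} = {}"
    and full: "stable_submodule R A act M (carrier M)" "supp (carrier M) = Z"
    and mono: "\<And>H H'. stable_submodule R A act M H \<Longrightarrow> stable_submodule R A act M H'
                 \<Longrightarrow> H \<subseteq> H' \<longleftrightarrow> supp H \<subseteq> supp H'"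
    and step: "\<And>H H'. stable_submodule R A act M H \<Longrightarrow> stable_submodule R A act M H' \<Longrightarrow> H \<subset> H'
                 \<Longrightarrow> \<exists>H'' x. stable_submodule R A act M H'' \<and> x \<notin> supp H \<and>
                      supp H'' = insert x (supp H) \<and> supp H'' \<subseteq> supp H'"
  shows "module_length R A act M = enat (card Z)"
proof -
  let ?st = "stable_submodule R A act M"
  have sub: "H \<subseteq> carrier M" if "?st H" for H
    using that unfolding stable_submodule_def submodule_def
    using subgroup.subset by fastforce
  have suppZ: "supp H \<subseteq> Z" if "?st H" for H
    using mono[OF that full(1)] sub[OF that] full(2) by auto
  have cover: "supp H' = insert x (supp H) \<Longrightarrow> x \<notin> supp H \<Longrightarrow> ?st H \<Longrightarrow> ?st H' \<Longrightarrow> H \<subset> H'"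
    for H H' x using mono[of H H'] mono[of H' H] by blast
  have len: "length Hs = Suc (card Z)" if cs: "composition_series R A act M Hs" for Hs
  proof -
    have ne: "Hs \<noteq> []" and hd: "hd Hs = {\<zero>\<^bsub>M\<^esub>}" and last: "last Hs = carrier M"
      and st: "\<And>j. j < length Hs \<Longrightarrow> ?st (Hs ! j)"
      and inc: "\<And>j. Suc j < length Hs \<Longrightarrow> Hs ! j \<subset> Hs ! Suc j"
      and nob: "\<And>j H. Suc j < length Hs \<Longrightarrow> ?st H \<Longrightarrow> Hs ! j \<subset> H \<Longrightarrow> H \<subset> Hs ! Suc j \<Longrightarrow> False"
      using cs unfolding composition_series_def by auto
    have "card (supp (Hs ! j)) = j" if "j < length Hs" for j
      using that
    proof (induction j)
      case 0
      then show ?case using hd zero(2) ne by (simp add: hd_conv_nth)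
    next
      case (Suc j)
      obtain H x where H: "?st H" "x \<notin> supp (Hs ! j)" "supp H = insert x (supp (Hs ! j))"
          "supp H \<subseteq> supp (Hs ! Suc j)"
        using step[OF st[of j] st[of "Suc j"] inc[of j]] Suc.prems by auto
      have "H = Hs ! Suc j"
        using nob[OF Suc.prems H(1) cover[OF H(3,2) _ H(1)]] mono[OF H(1) st[OF Suc.prems]] H(4)
          st[of j] Suc.prems by auto
      moreover have "finite (supp (Hs ! j))"
        using suppZ[OF st[of j]] Suc.prems fin by (auto intro: finite_subset)
      ultimately show ?case using H(2,3) Suc by auto
    qed
    from this[of "length Hs - 1"] ne last full(2) show ?thesis
      by (cases Hs rule: rev_cases) auto
  qed
  have ex: "\<exists>Hs. Hs \<noteq> [] \<and> hd Hs = H \<and> last Hs = carrier M \<and> (\<forall>H\<in>set Hs. ?st H) \<and>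
      (\<forall>j. Suc j < length Hs \<longrightarrow> Hs ! j \<subset> Hs ! Suc j \<and>
        \<not> (\<exists>H. ?st H \<and> Hs ! j \<subset> H \<and> H \<subset> Hs ! Suc j))" if "?st H" for H
    using that
  proof (induction "card (Z - supp H)" arbitrary: H rule: less_induct)
    case less
    show ?case
    proof (cases "H = carrier M")
      case True
      then show ?thesis using less.prems by (intro exI[of _ "[H]"]) auto
    next
      case False
      then have "H \<subset> carrier M" using sub[OF less.prems] by auto
      from step[OF less.prems full(1) this] obtain H' x
        where H': "?st H'" "x \<notin> supp H" "supp H' = insert x (supp H)" by auto
      have "Z - supp H' \<subset> Z - supp H" using H' suppZ[OF H'(1)] by auto
      then have "card (Z - supp H') < card (Z - supp H)" by (simp add: fin psubset_card_mono)
      from less.hyps[OF this H'(1)] obtain Hs where Hs: "Hs \<noteq> []" "hd Hs = H'"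
        "last Hs = carrier M" "\<forall>H\<in>set Hs. ?st H"
        "\<forall>j. Suc j < length Hs \<longrightarrow> Hs ! j \<subset> Hs ! Suc j \<and>
          \<not> (\<exists>H. ?st H \<and> Hs ! j \<subset> H \<and> H \<subset> Hs ! Suc j)" by blast
      have nob: "\<not> (\<exists>K. ?st K \<and> H \<subset> K \<and> K \<subset> H')"
      proof
        assume "\<exists>K. ?st K \<and> H \<subset> K \<and> K \<subset> H'"
        then obtain K where K: "?st K" "H \<subset> K" "K \<subset> H'" by blast
        have "supp H \<subset> supp K" "supp K \<subset> supp H'"
          using mono[OF less.prems K(1)] mono[OF K(1) less.prems] mono[OF K(1) H'(1)]
            mono[OF H'(1) K(1)] K by blast+
        then show False using H'(3) by (cases "x \<in> supp K") auto
      qed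
      have "H \<subset> H'" using cover[OF H'(3,2) less.prems H'(1)] .
      then have "\<forall>j. Suc j < length (H # Hs) \<longrightarrow> (H # Hs) ! j \<subset> (H # Hs) ! Suc j \<and>
          \<not> (\<exists>K. ?st K \<and> (H # Hs) ! j \<subset> K \<and> K \<subset> (H # Hs) ! Suc j)"
        using Hs(1,2,5) nob by (auto simp: nth_Cons hd_conv_nth split: nat.split)
      then show ?thesis using Hs less.prems by (intro exI[of _ "H # Hs"]) auto
    qed
  qed
  from ex[OF zero(1)] obtain Hs where "composition_series R A act M Hs"
    unfolding composition_series_def by blast
  then have "{enat l | l. \<exists>Hs. composition_series R A act M Hs \<and> length Hs = Suc l} = {enat (card Z)}"
    using len by auto
  then show ?thesis unfolding module_length_def by simp
qed

section \<open>Complements of upward closed sets of exponents\<close>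

abbreviation lookup where "lookup \<equiv> Poly_Mapping.lookup"
abbreviation keys where "keys \<equiv> Poly_Mapping.keys"
abbreviation unit_exp :: "'n \<Rightarrow> 'n \<Rightarrow>\<^sub>0 nat" where "unit_exp i \<equiv> Poly_Mapping.single i 1"

text \<open>The exponents of the monomials in an ideal form such a set; no order on exponents is used, since the
order of \<^type>\<open>poly_mapping\<close> is lexicographic.\<close>

definition upset :: "('n::finite \<Rightarrow>\<^sub>0 nat) set \<Rightarrow> bool" where
  "upset E \<longleftrightarrow> (\<forall>\<alpha>\<in>E. \<forall>\<beta>. \<alpha> + \<beta> \<in> E)"

lemma upsetD: "upset E \<Longrightarrow> \<alpha> \<in> E \<Longrightarrow> \<alpha> + \<beta> \<in> E"
  by (simp add: upset_def)

text \<open>The total degree of an exponent.\<close>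

definition tdeg :: "('n::finite \<Rightarrow>\<^sub>0 nat) \<Rightarrow> nat" where
  "tdeg \<alpha> = (\<Sum>i\<in>UNIV. lookup \<alpha> i)"

lemma tdeg_add: "tdeg (\<alpha> + \<beta>) = tdeg \<alpha> + tdeg \<beta>"
  by (simp add: tdeg_def lookup_add sum.distrib)

lemma tdeg_single [simp]: "tdeg (Poly_Mapping.single i m) = m"
  by (simp add: tdeg_def lookup_single when_def)

lemma tdeg_sum: "tdeg (sum f A) = (\<Sum>a\<in>A. tdeg (f a))"
  by (induction A rule: infinite_finite_induct) (auto simp: tdeg_add, simp_all add: tdeg_def)

lemma finite_tdeg: "finite {\<alpha> :: 'n::finite \<Rightarrow>\<^sub>0 nat. tdeg \<alpha> = d}"
proof -
  have "lookup \<alpha> i \<le> d" if "tdeg \<alpha> = d" for \<alpha> :: "'n \<Rightarrow>\<^sub>0 nat" and i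
    unfolding that[symmetric] tdeg_def by (rule member_le_sum) simp_all
  then have "lookup ` {\<alpha>. tdeg \<alpha> = d} \<subseteq> (UNIV \<rightarrow>\<^sub>E {..d} :: ('n \<Rightarrow> nat) set)"
    by auto
  moreover have "finite (UNIV \<rightarrow>\<^sub>E {..d} :: ('n \<Rightarrow> nat) set)" by (rule finite_PiE) simp_all
  ultimately have "finite (lookup ` {\<alpha> :: 'n \<Rightarrow>\<^sub>0 nat. tdeg \<alpha> = d})" by (rule finite_subset)
  moreover have "inj_on lookup {\<alpha> :: 'n \<Rightarrow>\<^sub>0 nat. tdeg \<alpha> = d}"
    by (rule inj_onI, rule poly_mapping_eqI) simp
  ultimately show ?thesis by (rule finite_imageD)
qed

text \<open>Coordinatewise form of Dickson's lemma: pass to monotone subsequences one coordinate after the other.\<close>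

lemma monotone_subsequence:
  fixes f :: "nat \<Rightarrow> 'n::finite \<Rightarrow>\<^sub>0 nat"
  shows "\<exists>s :: nat \<Rightarrow> nat. strict_mono s \<and> (\<forall>i. mono (\<lambda>m. lookup (f (s m)) i))"
proof -
  have "\<exists>s :: nat \<Rightarrow> nat. strict_mono s \<and> (\<forall>i\<in>C. mono (\<lambda>m. lookup (f (s m)) i))" if "finite C" for C
    using that
  proof (induction C)
    case empty
    have "strict_mono (\<lambda>m::nat. m)" by (simp add: strict_mono_def)
    then show ?case by auto
  next
    case (insert c C)
    then obtain s :: "nat \<Rightarrow> nat" where s: "strict_mono s" "\<forall>i\<in>C. mono (\<lambda>m. lookup (f (s m)) i)" by auto
    obtain t where t: "strict_mono t" "monoseq (\<lambda>m. lookup (f (s (t m))) c)"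
      using seq_monosub[of "\<lambda>m. lookup (f (s m)) c"] by auto
    have "\<exists>u :: nat \<Rightarrow> nat. strict_mono u \<and> mono (\<lambda>m. lookup (f (s (t (u m)))) c)"
    proof (cases "incseq (\<lambda>m. lookup (f (s (t m))) c)")
      case True
      then show ?thesis by (intro exI[of _ "\<lambda>m. m"]) (auto simp: strict_mono_def)
    next
      case False
      define g where "g = (\<lambda>m. lookup (f (s (t m))) c)"
      have dec: "decseq g" using False t(2) unfolding monoseq_iff g_def by auto
      \<comment> \<open>A decreasing sequence of naturals is constant from its minimum on.\<close>
      define k where "k = (ARG_MIN g n. True)"
      have "g k \<le> g n" for n unfolding k_def by (rule arg_min_nat_le) simp
      then have "g (k + m) = g k" for m using decseqD[OF dec, of k "k + m"] by (simp add: le_antisym)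
      then show ?thesis
        by (intro exI[of _ "\<lambda>m. k + m"]) (auto simp: strict_mono_def g_def mono_def)
    qed
    then obtain u :: "nat \<Rightarrow> nat" where u: "strict_mono u" "mono (\<lambda>m. lookup (f (s (t (u m)))) c)" by auto
    have tu: "strict_mono (\<lambda>m. t (u m))" using strict_mono_o[OF t(1) u(1)] by (simp add: o_def)
    then have "mono (\<lambda>m. t (u m))" by (rule strict_mono_mono)
    then have "mono (\<lambda>m. lookup (f (s (t (u m)))) i)" if "i \<in> C" for i
      using s(2) that by (auto intro!: monoI dest: monoD)
    moreover have "strict_mono (\<lambda>m. s (t (u m)))"
      using strict_mono_o[OF s(1) tu] by (simp add: o_def)
    ultimately show ?case using u(2) by (intro exI[of _ "\<lambda>m. s (t (u m))"]) auto
  qed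
  from this[of UNIV] show ?thesis by auto
qed

lemma upset_chain_stabilises:
  fixes E :: "nat \<Rightarrow> ('n::finite \<Rightarrow>\<^sub>0 nat) set"
  assumes up: "\<And>m. upset (E m)" and inc: "mono E"
  shows "\<exists>M. \<forall>m\<ge>M. E m = E M"
proof (rule ccontr)
  assume "\<not> ?thesis"
  then have "\<And>M. \<exists>m g. m > M \<and> g \<in> E m - E M"
  proof -
    fix M
    from \<open>\<not> (\<exists>M. \<forall>m\<ge>M. E m = E M)\<close> obtain m where m: "m \<ge> M" "E m \<noteq> E M" by blast
    then have "m > M" "\<not> E m \<subseteq> E M" using monoD[OF inc m(1)] by (auto simp: le_less)
    then show "\<exists>m g. m > M \<and> g \<in> E m - E M" by blast
  qed
  then have "\<forall>M. \<exists>p. fst p > M \<and> snd p \<in> E (fst p) - E M" by fastforce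
  from choice[OF this] obtain p where p: "\<And>M. fst (p M) > M \<and> snd (p M) \<in> E (fst (p M)) - E M" by blast
  define nx g where "nx = (\<lambda>M. fst (p M))" and "g = (\<lambda>M. snd (p M))"
  have nx: "\<And>M. nx M > M" "\<And>M. g M \<in> E (nx M) - E M" using p by (auto simp: nx_def g_def)
  define q where "q = rec_nat 0 (\<lambda>_. nx)"
  have q: "q (Suc m) = nx (q m)" for m by (simp add: q_def)
  then have smq: "strict_mono q" using nx(1) by (simp add: strict_mono_Suc_iff)
  obtain s :: "nat \<Rightarrow> nat" where s: "strict_mono s" "\<And>i. mono (\<lambda>m. lookup (g (q (s m))) i)"
    using monotone_subsequence[of "\<lambda>m. g (q m)"] by auto
  have le: "lookup (g (q (s 0))) i \<le> lookup (g (q (s 1))) i" for i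
    using monoD[OF s(2), of 0 1] by simp
  have "g (q (s 1)) = g (q (s 0)) + (g (q (s 1)) - g (q (s 0)))"
    by (rule poly_mapping_eqI) (use le in \<open>simp add: lookup_add lookup_minus\<close>)
  moreover have "g (q (s 0)) \<in> E (q (s 1))"
  proof -
    have "Suc (s 0) \<le> s 1" using s(1) by (simp add: strict_mono_def Suc_le_eq)
    then have "E (nx (q (s 0))) \<subseteq> E (q (s 1))"
      using monoD[OF inc monoD[OF strict_mono_mono[OF smq]]] q by metis
    then show ?thesis using nx(2) by blast
  qed
  ultimately have "g (q (s 1)) \<in> E (q (s 1))" using upsetD[OF up] by metis
  then show False using nx(2) by blast
qed

lemma rational_fps_add:
  assumes "rational_fps F" "rational_fps G" shows "rational_fps (F + G)"
proof -
  obtain p q p' q' where "q \<noteq> 0" "fps_of_poly q * F = fps_of_poly p"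
    "q' \<noteq> 0" "fps_of_poly q' * G = fps_of_poly p'"
    using assms unfolding rational_fps_def by auto
  then have "fps_of_poly (q * q') * (F + G) = fps_of_poly (p * q' + p' * q)" "q * q' \<noteq> 0"
    by (auto simp: fps_of_poly_mult fps_of_poly_add ring_distribs mult_ac dest: sym)
  then show ?thesis unfolding rational_fps_def by blast
qed

lemma rational_fps_X_mult:
  assumes "rational_fps F" shows "rational_fps (fps_X * F)"
proof -
  obtain p q where "q \<noteq> 0" "fps_of_poly q * F = fps_of_poly p"
    using assms unfolding rational_fps_def by auto
  then have "fps_of_poly q * (fps_X * F) = fps_of_poly ([:0, 1:] * p)"
    by (simp only: fps_of_poly_mult fps_of_poly_fps_X) (simp add: mult.left_commute)
  then show ?thesis using \<open>q \<noteq> 0\<close> unfolding rational_fps_def by blast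
qed

text \<open>The equation says that \<open>(1 - t) F = G\<close>.\<close>

lemma rational_fps_div:
  fixes F G :: "'a::field fps"
  assumes "rational_fps G" "F = G + fps_X * F" shows "rational_fps F"
proof -
  obtain p q where pq: "q \<noteq> 0" "fps_of_poly q * G = fps_of_poly p"
    using assms unfolding rational_fps_def by auto
  have "(1 - fps_X) * F = G" using assms(2) by (simp add: algebra_simps)
  then have "fps_of_poly (q * (1 - [:0, 1:])) * F = fps_of_poly p"
    using pq(2) by (simp only: fps_of_poly_mult fps_of_poly_diff fps_of_poly_1 fps_of_poly_fps_X mult.assoc)
  moreover have "1 - [:0, 1:] = [:1, - 1 :: 'a:]" by (simp add: one_pCons)
  then have "1 - [:0, 1 :: 'a:] \<noteq> 0" by (simp only: pCons_eq_0_iff) simp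
  then have "q * (1 - [:0, 1:]) \<noteq> 0" using pq(1) by (simp only: mult_eq_0_iff) simp
  ultimately show ?thesis unfolding rational_fps_def by blast
qed

text \<open>The generating function counting, by total degree, the exponents in the variables \<open>C\<close> outside \<open>E\<close>.\<close>

definition complement_series :: "'n set \<Rightarrow> ('n::finite \<Rightarrow>\<^sub>0 nat) set \<Rightarrow> rat fps" where
  "complement_series C E =
     Abs_fps (\<lambda>d. of_nat (card {\<alpha>. keys \<alpha> \<subseteq> C \<and> tdeg \<alpha> = d \<and> \<alpha> \<notin> E}))"

text \<open>An exponent in the variables \<open>insert c C\<close> either does not involve \<open>c\<close>, or is \<open>\<alpha> + e\<^sub>c\<close> for a unique \<open>\<alpha>\<close>.\<close>

lemma complement_series_insert:
  assumes c: "c \<notin> C"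
  shows "complement_series (insert c C) E =
    complement_series C E + fps_X * complement_series (insert c C) {\<alpha>. \<alpha> + unit_exp c \<in> E}"
    (is "?l = _ + fps_X * ?r")
proof (rule fps_ext)
  fix d
  let ?A = "\<lambda>C E d. {\<alpha>. keys \<alpha> \<subseteq> C \<and> tdeg \<alpha> = d \<and> \<alpha> \<notin> E}"
  let ?E = "{\<alpha>. \<alpha> + unit_exp c \<in> E}"
  let ?B = "{\<alpha> \<in> ?A (insert c C) E d. lookup \<alpha> c > 0}"
  have fin: "finite (?A C E d)" "finite ?B"
    using finite_tdeg[of d] by (auto intro: rev_finite_subset)
  have "?A (insert c C) E d = ?A C E d \<union> ?B"
    using c by (auto simp: in_keys_iff subset_iff)
  moreover have "?A C E d \<inter> ?B = {}" using c by (auto simp: in_keys_iff subset_iff)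
  ultimately have *: "card (?A (insert c C) E d) = card (?A C E d) + card ?B"
    using card_Un_disjoint[OF fin] by (simp only:)
  show "fps_nth ?l d = fps_nth (complement_series C E + fps_X * ?r) d"
  proof (cases d)
    case 0
    have "\<not> lookup \<alpha> c > 0" if "tdeg \<alpha> = 0" for \<alpha> using that by (simp add: tdeg_def)
    then have "?B = {}" using 0 by blast
    then have "card ?B = 0" by (simp only: card.empty)
    then show ?thesis using * 0 by (simp add: complement_series_def)
  next
    case (Suc d')
    have "bij_betw (\<lambda>\<alpha>. \<alpha> + unit_exp c) (?A (insert c C) ?E d') ?B"
    proof (rule bij_betw_imageI)
      show "(\<lambda>\<alpha>. \<alpha> + unit_exp c) ` ?A (insert c C) ?E d' = ?B"
      proof (intro equalityI subsetI)
        fix \<beta> assume \<beta>: "\<beta> \<in> ?B"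
        then have eq: "\<beta> - unit_exp c + unit_exp c = \<beta>"
          by (intro poly_mapping_eqI) (auto simp: lookup_add lookup_minus lookup_single when_def)
        have "tdeg (\<beta> - unit_exp c) = d'"
          using arg_cong[OF eq, of tdeg] \<beta> Suc by (simp add: tdeg_add)
        moreover have "keys (\<beta> - unit_exp c) \<subseteq> insert c C"
          using \<beta> by (auto simp: in_keys_iff lookup_minus lookup_single when_def subset_iff)
        ultimately have "\<beta> - unit_exp c \<in> ?A (insert c C) ?E d'"
          using \<beta> unfolding mem_Collect_eq eq by blast
        then show "\<beta> \<in> (\<lambda>\<alpha>. \<alpha> + unit_exp c) ` ?A (insert c C) ?E d'"
          by (rule image_eqI[rotated]) (rule eq[symmetric])
      next
        fix \<beta> assume "\<beta> \<in> (\<lambda>\<alpha>. \<alpha> + unit_exp c) ` ?A (insert c C) ?E d'"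
        then obtain \<alpha> where \<alpha>: "\<beta> = \<alpha> + unit_exp c" "keys \<alpha> \<subseteq> insert c C" "tdeg \<alpha> = d'" "\<beta> \<notin> E"
          by auto
        have "keys \<beta> \<subseteq> insert c C"
          unfolding \<alpha>(1) by (rule order.trans[OF Poly_Mapping.keys_add]) (use \<alpha>(2) in auto)
        then show "\<beta> \<in> ?B" using \<alpha> Suc by (simp add: tdeg_add lookup_add)
      qed
    qed (auto simp: inj_on_def)
    then have "card ?B = card (?A (insert c C) ?E d')" by (simp add: bij_betw_same_card)
    then show ?thesis using * Suc by (simp add: complement_series_def)
  qed
qed

theorem rational_complement_series:
  assumes "finite C" "upset E" shows "rational_fps (complement_series C E)"
  using assms
proof (induction C arbitrary: E)
  case empty
  have "fps_nth (complement_series {} E) d = 0" if "d > 0" for d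
    using that by (auto simp: complement_series_def tdeg_def keys_eq_empty)
  then have "complement_series {} E = fps_const (fps_nth (complement_series {} E) 0)"
    by (intro fps_ext) auto
  then have "fps_of_poly 1 * complement_series {} E = fps_of_poly [:fps_nth (complement_series {} E) 0:]"
    by (simp add: fps_of_poly_const)
  then show ?case unfolding rational_fps_def by (intro exI[of _ "1::rat poly"] exI conjI) auto
next
  case (insert c C)
  define S where "S m = {\<alpha>. \<alpha> + Poly_Mapping.single c m \<in> E}" for m
  have S_Suc: "{\<alpha>. \<alpha> + unit_exp c \<in> S m} = S (Suc m)" for m
    by (simp add: S_def add.assoc flip: single_add)
  have up: "upset (S m)" for m
  proof (unfold upset_def, intro ballI allI)
    fix \<alpha> \<beta> assume "\<alpha> \<in> S m"
    then have "\<alpha> + Poly_Mapping.single c m + \<beta> \<in> E" using upsetD[OF insert.prems] by (simp add: S_def)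
    then show "\<alpha> + \<beta> \<in> S m" by (simp add: S_def add_ac)
  qed
  have "S m \<subseteq> S (Suc m)" for m
    using upsetD[OF up[of m]] S_Suc[of m] by blast
  then have "mono S" by (simp add: mono_iff_le_Suc)
  from upset_chain_stabilises[OF up this] obtain M where M: "\<And>m. m \<ge> M \<Longrightarrow> S m = S M" by blast
  have rec: "complement_series (insert c C) (S m) =
    complement_series C (S m) + fps_X * complement_series (insert c C) (S (Suc m))" for m
    using complement_series_insert[OF insert.hyps(2), of "S m"] by (simp only: S_Suc)
  have "rational_fps (complement_series (insert c C) (S m))" if "m \<le> M" for m
    using that
  proof (induction m rule: inc_induct)
    case base
    show ?case by (rule rational_fps_div[OF insert.IH[OF up[of M]]]) (use rec[of M] M[of "Suc M"] in simp)
  next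
    case (step m)
    show ?case
      by (subst rec) (intro rational_fps_add rational_fps_X_mult insert.IH up step.IH)
  qed
  from this[of 0] show ?case by (simp add: S_def)
qed

section \<open>Exponent sets of stable submodules\<close>

text \<open>The literal \<open>1\<close> has to stay intact for the rules about \<open>unit_exp\<close> to apply.\<close>

declare One_nat_def [simp del]

lemma exp_remove_add [simp]: "lookup \<alpha> j > 0 \<Longrightarrow> \<alpha> - unit_exp j + unit_exp j = \<alpha>"
  by (rule poly_mapping_eqI) (auto simp: lookup_add lookup_minus lookup_single when_def)

lemma exp_remove_add' [simp]: "lookup \<alpha> j > 0 \<Longrightarrow> unit_exp j + (\<alpha> - unit_exp j) = \<alpha>"
  by (rule poly_mapping_eqI) (auto simp: lookup_add lookup_minus lookup_single when_def)

lemma exp_add_remove: "\<alpha> + unit_exp j - unit_exp j = (\<alpha> :: 'n \<Rightarrow>\<^sub>0 nat)"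
  by (rule poly_mapping_eqI) (auto simp: lookup_add lookup_minus lookup_single when_def)

text \<open>\<open>E\<close> stands for the set of exponents of the monomials in a monomial ideal; all notions below depend on it.\<close>

locale monomial_upset =
  fixes E :: "('n::finite \<Rightarrow>\<^sub>0 nat) set"
  assumes up: "upset E"
begin

text \<open>The derivation \<open>x\<^sub>l \<partial>\<^sub>j\<close> preserves the ideal: a factor \<open>x\<^sub>j\<close> may be replaced by \<open>x\<^sub>l\<close> in its monomials.\<close>

definition replaceable :: "'n \<Rightarrow> 'n \<Rightarrow> bool" where
  "replaceable j l \<longleftrightarrow> (\<forall>\<beta>\<in>E. lookup \<beta> j > 0 \<longrightarrow> \<beta> - unit_exp j + unit_exp l \<in> E)"

text \<open>The variables with index in \<open>N\<close>, those for which \<open>\<partial>\<^sub>j\<close> does not preserve the ideal.\<close>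

definition active :: "'n set" where
  "active = {j. \<exists>\<beta>\<in>E. lookup \<beta> j > 0 \<and> \<beta> - unit_exp j \<notin> E}"

text \<open>The degree in the active variables; \<open>adeg_ge i\<close> collects the exponents of the monomials in \<open>J\<^sup>i\<close>.\<close>

definition adeg :: "('n \<Rightarrow>\<^sub>0 nat) \<Rightarrow> nat" where
  "adeg \<alpha> = (\<Sum>j\<in>active. lookup \<alpha> j)"

definition adeg_ge :: "nat \<Rightarrow> ('n \<Rightarrow>\<^sub>0 nat) set" where
  "adeg_ge i = {\<alpha>. i \<le> adeg \<alpha>}"

text \<open>The exponent sets of the \<open>T\<^sub>B(I)\<close>-stable ideals between \<open>J\<^sup>i\<^sup>+\<^sup>1 + I\<close> and \<open>J\<^sup>i + I\<close>, see \<open>T_B_stable_ideal\<close> and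
\<open>admissible_T_B_stable\<close> for the two directions.\<close>

definition admissible :: "nat \<Rightarrow> ('n \<Rightarrow>\<^sub>0 nat) set \<Rightarrow> bool" where
  "admissible i U \<longleftrightarrow> upset U \<and> adeg_ge (Suc i) \<union> E \<subseteq> U \<and> U \<subseteq> adeg_ge i \<union> E \<and>
     (\<forall>\<alpha>\<in>U. \<forall>j. j \<notin> active \<longrightarrow> lookup \<alpha> j > 0 \<longrightarrow> \<alpha> - unit_exp j \<in> U) \<and>
     (\<forall>\<alpha>\<in>U. \<forall>j l. replaceable j l \<longrightarrow> lookup \<alpha> j > 0 \<longrightarrow> \<alpha> - unit_exp j + unit_exp l \<in> U)"

lemma E_remove: "\<alpha> \<in> E \<Longrightarrow> j \<notin> active \<Longrightarrow> lookup \<alpha> j > 0 \<Longrightarrow> \<alpha> - unit_exp j \<in> E"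
  by (auto simp: active_def)

lemma E_replace:
  "\<alpha> \<in> E \<Longrightarrow> replaceable j l \<Longrightarrow> lookup \<alpha> j > 0 \<Longrightarrow> \<alpha> - unit_exp j + unit_exp l \<in> E"
  by (auto simp: replaceable_def)

lemma replaceable_refl: "replaceable j j"
  by (auto simp: replaceable_def)

lemma replaceable_trans:
  assumes "replaceable j l" "replaceable l m" shows "replaceable j m"
  unfolding replaceable_def
proof (intro ballI impI)
  fix \<beta> assume "\<beta> \<in> E" "lookup \<beta> j > 0"
  then have "\<beta> - unit_exp j + unit_exp l \<in> E" using assms(1) E_replace by blast
  from E_replace[OF this assms(2)] show "\<beta> - unit_exp j + unit_exp m \<in> E"
    by (simp add: lookup_add exp_add_remove)
qed

lemma replaceable_active:
  assumes "replaceable j l" "j \<in> active" shows "l \<in> active"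
proof (rule ccontr)
  assume l: "l \<notin> active"
  obtain \<beta> where \<beta>: "\<beta> \<in> E" "lookup \<beta> j > 0" "\<beta> - unit_exp j \<notin> E"
    using assms(2) by (auto simp: active_def)
  have "\<beta> - unit_exp j + unit_exp l \<in> E" using \<beta> assms(1) E_replace by blast
  from E_remove[OF this l] show False using \<beta>(3) by (simp add: lookup_add exp_add_remove)
qed

lemma adeg_add: "adeg (\<alpha> + \<beta>) = adeg \<alpha> + adeg \<beta>"
  by (simp add: adeg_def lookup_add sum.distrib)

lemma adeg_unit: "adeg (unit_exp j) = (if j \<in> active then 1 else 0)"
  by (simp add: adeg_def lookup_single when_def)

lemma upset_adeg_ge: "upset (adeg_ge i)"
  by (simp add: upset_def adeg_ge_def adeg_add)

lemma adeg_remove: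
  assumes "lookup \<alpha> j > 0" shows "adeg \<alpha> = adeg (\<alpha> - unit_exp j) + (if j \<in> active then 1 else 0)"
  using arg_cong[OF exp_remove_add[OF assms], of adeg] by (simp add: adeg_add adeg_unit)

lemma adeg_le_replace:
  assumes "lookup \<alpha> j > 0" "replaceable j l"
  shows "adeg \<alpha> \<le> adeg (\<alpha> - unit_exp j + unit_exp l)"
  using adeg_remove[OF assms(1)] replaceable_active[OF assms(2)] by (auto simp: adeg_add adeg_unit)

lemma admissible_adeg_ge:
  assumes "k = i \<or> k = Suc i" shows "admissible i (adeg_ge k \<union> E)"
proof -
  have "adeg_ge (Suc i) \<subseteq> adeg_ge k" "adeg_ge k \<subseteq> adeg_ge i" using assms by (auto simp: adeg_ge_def)
  moreover have "upset (adeg_ge k \<union> E)" using upset_adeg_ge[of k] up by (auto simp: upset_def)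
  moreover have "\<alpha> - unit_exp j \<in> adeg_ge k \<union> E"
    if "\<alpha> \<in> adeg_ge k \<union> E" "j \<notin> active" "lookup \<alpha> j > 0" for \<alpha> j
    using that E_remove adeg_remove[OF that(3)] by (auto simp: adeg_ge_def)
  moreover have "\<alpha> - unit_exp j + unit_exp l \<in> adeg_ge k \<union> E"
    if "\<alpha> \<in> adeg_ge k \<union> E" "replaceable j l" "lookup \<alpha> j > 0" for \<alpha> j l
    using that E_replace adeg_le_replace[OF that(3,2)] by (auto simp: adeg_ge_def)
  ultimately show ?thesis unfolding admissible_def by blast
qed

text \<open>A chosen representative of the class of \<open>j\<close> under mutual replaceability. Classes are encoded by their
representatives, so class degrees are again exponents in the same variables.\<close>

definition cls :: "'n \<Rightarrow> 'n" where
  "cls j = (SOME l. replaceable j l \<and> replaceable l j)"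

lemma cls: "replaceable j (cls j)" "replaceable (cls j) j"
proof -
  have "replaceable j (cls j) \<and> replaceable (cls j) j"
    unfolding cls_def by (rule someI[of _ j]) (simp add: replaceable_refl)
  then show "replaceable j (cls j)" "replaceable (cls j) j" by auto
qed

lemma cls_eq_iff: "cls j = cls l \<longleftrightarrow> replaceable j l \<and> replaceable l j"
proof
  assume "cls j = cls l"
  then show "replaceable j l \<and> replaceable l j" using cls[of j] cls[of l] replaceable_trans by metis
next
  assume "replaceable j l \<and> replaceable l j"
  then have "(replaceable j m \<and> replaceable m j) = (replaceable l m \<and> replaceable m l)" for m
    using replaceable_trans by blast
  then show "cls j = cls l" by (simp add: cls_def)
qed

lemma cls_cls [simp]: "cls (cls j) = cls j"
  using cls by (simp add: cls_eq_iff)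

lemma cls_active: "cls j \<in> active \<longleftrightarrow> j \<in> active"
  using cls replaceable_active by blast

text \<open>The class degree: the degrees in all active variables of one class are added up and recorded at the
representative of the class.\<close>

definition cdeg :: "('n \<Rightarrow>\<^sub>0 nat) \<Rightarrow> 'n \<Rightarrow>\<^sub>0 nat" where
  "cdeg \<alpha> = (\<Sum>j\<in>active. Poly_Mapping.single (cls j) (lookup \<alpha> j))"

lemma lookup_cdeg: "lookup (cdeg \<alpha>) c = (\<Sum>j\<in>{j\<in>active. cls j = c}. lookup \<alpha> j)"
  by (simp add: cdeg_def lookup_sum lookup_single when_def sum.inter_filter)

lemma tdeg_cdeg: "tdeg (cdeg \<alpha>) = adeg \<alpha>"
  by (simp add: cdeg_def tdeg_sum adeg_def)

lemma cdeg_add: "cdeg (\<alpha> + \<beta>) = cdeg \<alpha> + cdeg \<beta>"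
  by (simp add: cdeg_def lookup_add single_add sum.distrib)

lemma cdeg_single:
  "cdeg (Poly_Mapping.single j m) = (if j \<in> active then Poly_Mapping.single (cls j) m else 0)"
proof -
  have "cdeg (Poly_Mapping.single j m) = (\<Sum>l\<in>active. if j = l then Poly_Mapping.single (cls l) m else 0)"
    unfolding cdeg_def by (rule sum.cong) (auto simp: lookup_single when_def)
  then show ?thesis by simp
qed

lemma cdeg_sum: "cdeg (sum f A) = (\<Sum>a\<in>A. cdeg (f a))"
proof -
  have "cdeg 0 = 0" by (simp add: cdeg_def)
  then show ?thesis by (induction A rule: infinite_finite_induct) (auto simp: cdeg_add)
qed

lemma cdeg_cdeg: "cdeg (cdeg \<alpha>) = cdeg \<alpha>"
  by (subst (2) cdeg_def) (simp add: cdeg_sum cdeg_single cls_active cdeg_def[of \<alpha>])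

lemma cdeg_remove:
  "lookup \<alpha> j > 0 \<Longrightarrow> cdeg \<alpha> = cdeg (\<alpha> - unit_exp j) + cdeg (unit_exp j)"
  by (metis cdeg_add exp_remove_add)

lemma cdeg_replace:
  assumes "cls j = cls l" "lookup \<alpha> j > 0"
  shows "cdeg (\<alpha> - unit_exp j + unit_exp l) = cdeg \<alpha>"
proof -
  have "j \<in> active \<longleftrightarrow> l \<in> active" using cls_active[of j] cls_active[of l] assms(1) by simp
  then show ?thesis using cdeg_remove[OF assms(2)] assms(1) by (simp add: cdeg_add cdeg_single)
qed

text \<open>Two exponents with the same class degree are linked by adding and removing inactive variables and by
moving degree between equivalent variables. Each such move can be chosen to bring the two exponents
closer in the \<open>l\<^sup>1\<close>-distance, which drives the induction.\<close>

lemma cdeg_saturated: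
  assumes W: "upset W"
    and rem: "\<And>\<alpha> j. \<alpha> \<in> W \<Longrightarrow> j \<notin> active \<Longrightarrow> lookup \<alpha> j > 0 \<Longrightarrow> \<alpha> - unit_exp j \<in> W"
    and rpl: "\<And>\<alpha> j l. \<alpha> \<in> W \<Longrightarrow> replaceable j l \<Longrightarrow> lookup \<alpha> j > 0 \<Longrightarrow> \<alpha> - unit_exp j + unit_exp l \<in> W"
    and "\<alpha> \<in> W" "cdeg \<alpha> = cdeg \<beta>"
  shows "\<beta> \<in> W"
  using assms(4,5)
proof (induction "\<Sum>j\<in>UNIV. (lookup \<alpha> j - lookup \<beta> j) + (lookup \<beta> j - lookup \<alpha> j)"
    arbitrary: \<alpha> rule: less_induct)
  case less
  \<comment> \<open>The two truncated differences add up to the absolute value of the difference.\<close>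
  let ?d = "\<lambda>\<alpha> j. (lookup \<alpha> j - lookup \<beta> j) + (lookup \<beta> j - lookup \<alpha> j)"
  have dec: "(\<Sum>j\<in>UNIV. ?d \<alpha>' j) < (\<Sum>j\<in>UNIV. ?d \<alpha> j)"
    if "\<And>j. ?d \<alpha>' j \<le> ?d \<alpha> j" "?d \<alpha>' j < ?d \<alpha> j" for \<alpha>' j
    by (rule sum_strict_mono_ex1) (use that in \<open>auto\<close>)
  show ?case
  proof (cases "\<alpha> = \<beta>")
    case True
    then show ?thesis using less.prems(1) by simp
  next
    case False
    then obtain j where j: "lookup \<alpha> j \<noteq> lookup \<beta> j"
      using poly_mapping_eqI[of \<alpha> \<beta>] by blast
    then consider (out_gt) "j \<notin> active" "lookup \<alpha> j > lookup \<beta> j"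
      | (out_lt) "j \<notin> active" "lookup \<alpha> j < lookup \<beta> j"
      | (inside) "j \<in> active"
      by (cases "j \<in> active") (auto simp: neq_iff)
    then show ?thesis
    proof cases
      case out_gt
      have "\<alpha> - unit_exp j \<in> W" using rem less.prems(1) out_gt by simp
      moreover have "cdeg (\<alpha> - unit_exp j) = cdeg \<beta>"
        using cdeg_remove[of \<alpha> j] out_gt less.prems(2) by (simp add: cdeg_single)
      moreover have "(\<Sum>x\<in>UNIV. ?d (\<alpha> - unit_exp j) x) < (\<Sum>x\<in>UNIV. ?d \<alpha> x)"
        by (rule dec[of "\<alpha> - unit_exp j" j]) (use out_gt in \<open>auto simp: lookup_minus lookup_single when_def\<close>)
      ultimately show ?thesis using less.hyps by blast
    next
      case out_lt
      have "\<alpha> + unit_exp j \<in> W" using upsetD[OF W] less.prems(1) by simp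
      moreover have "cdeg (\<alpha> + unit_exp j) = cdeg \<beta>"
        using out_lt less.prems(2) by (simp add: cdeg_single cdeg_add)
      moreover have "(\<Sum>x\<in>UNIV. ?d (\<alpha> + unit_exp j) x) < (\<Sum>x\<in>UNIV. ?d \<alpha> x)"
        by (rule dec[of "\<alpha> + unit_exp j" j]) (use out_lt in \<open>auto simp: lookup_add lookup_single when_def\<close>)
      ultimately show ?thesis using less.hyps by blast
    next
      case inside
      let ?C = "{l\<in>active. cls l = cls j}"
      have eq: "(\<Sum>l\<in>?C. lookup \<alpha> l) = (\<Sum>l\<in>?C. lookup \<beta> l)"
        using less.prems(2) by (simp flip: lookup_cdeg)
      have "\<exists>l\<in>?C. f l > g l" if "(\<Sum>l\<in>?C. f l) = (\<Sum>l\<in>?C. g l)" "f j \<noteq> g j" for f g :: "'n \<Rightarrow> nat"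
      proof (rule ccontr)
        assume "\<not> (\<exists>l\<in>?C. f l > g l)"
        then have le: "\<And>l. l \<in> ?C \<Longrightarrow> f l \<le> g l" by (meson leI)
        then have "f j < g j" using that(2) inside by (simp add: le_neq_implies_less)
        then have "(\<Sum>l\<in>?C. f l) < (\<Sum>l\<in>?C. g l)"
          by (intro sum_strict_mono_ex1) (use le inside in auto)
        then show False using that(1) by simp
      qed
      from this[OF eq j] this[OF eq[symmetric] j[symmetric]]
      obtain l m where lm: "l \<in> ?C" "lookup \<alpha> l > lookup \<beta> l" "m \<in> ?C" "lookup \<alpha> m < lookup \<beta> m" by blast
      have "cls l = cls m" using lm by simp
      then have "\<alpha> - unit_exp l + unit_exp m \<in> W" "cdeg (\<alpha> - unit_exp l + unit_exp m) = cdeg \<beta>"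
        using rpl[OF less.prems(1)] lm less.prems(2) cdeg_replace[of l m \<alpha>]
        by (auto simp: cls_eq_iff)
      moreover have "(\<Sum>x\<in>UNIV. ?d (\<alpha> - unit_exp l + unit_exp m) x) < (\<Sum>x\<in>UNIV. ?d \<alpha> x)"
        by (rule dec[of "\<alpha> - unit_exp l + unit_exp m" l]) (use lm in \<open>auto simp: lookup_add lookup_minus lookup_single when_def\<close>)
      ultimately show ?thesis using less.hyps by blast
    qed
  qed
qed

lemma E_saturated: "\<alpha> \<in> E \<Longrightarrow> cdeg \<alpha> = cdeg \<beta> \<Longrightarrow> \<beta> \<in> E"
  using cdeg_saturated[OF up E_remove E_replace] by blast

lemma admissible_saturated:
  assumes "admissible i U" "\<alpha> \<in> U" "cdeg \<alpha> = cdeg \<beta>" shows "\<beta> \<in> U"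
  by (rule cdeg_saturated[of U \<alpha>]) (use assms in \<open>auto simp: admissible_def\<close>)

text \<open>The class degrees of an admissible set outside the smallest one. By saturation they determine the set.\<close>

definition cdegs :: "nat \<Rightarrow> ('n \<Rightarrow>\<^sub>0 nat) set \<Rightarrow> ('n \<Rightarrow>\<^sub>0 nat) set" where
  "cdegs i U = cdeg ` (U - (adeg_ge (Suc i) \<union> E))"

lemma cdegs_iff:
  assumes "admissible i U" shows "\<alpha> \<in> U \<longleftrightarrow> \<alpha> \<in> adeg_ge (Suc i) \<union> E \<or> cdeg \<alpha> \<in> cdegs i U"
proof
  assume "\<alpha> \<in> adeg_ge (Suc i) \<union> E \<or> cdeg \<alpha> \<in> cdegs i U"
  then show "\<alpha> \<in> U"
  proof
    assume "cdeg \<alpha> \<in> cdegs i U"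
    then obtain \<beta> where "\<beta> \<in> U" "cdeg \<alpha> = cdeg \<beta>" by (auto simp: cdegs_def)
    then show ?thesis using admissible_saturated[OF assms] by metis
  qed (use assms in \<open>auto simp: admissible_def\<close>)
qed (auto simp: cdegs_def)

lemma cdegs_mono:
  assumes "admissible i U" "admissible i U'" shows "U \<subseteq> U' \<longleftrightarrow> cdegs i U \<subseteq> cdegs i U'"
proof
  assume "cdegs i U \<subseteq> cdegs i U'"
  then show "U \<subseteq> U'" using cdegs_iff[OF assms(1)] cdegs_iff[OF assms(2)] by blast
qed (auto simp: cdegs_def)

lemma finite_cdegs:
  assumes "admissible i U" shows "finite (cdegs i U)"
proof (rule finite_subset)
  have "adeg \<alpha> = i" if "\<alpha> \<in> U - (adeg_ge (Suc i) \<union> E)" for \<alpha>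
    using that assms unfolding admissible_def adeg_ge_def by (auto simp: subset_iff le_antisym not_le)
  then show "cdegs i U \<subseteq> {\<gamma>. tdeg \<gamma> = i}" by (auto simp: cdegs_def tdeg_cdeg)
qed (rule finite_tdeg)

text \<open>Each variable is weighted by the number of variables it can replace, so that the weight strictly
increases when a variable is replaced by an inequivalent one.\<close>

definition wt :: "('n \<Rightarrow>\<^sub>0 nat) \<Rightarrow> nat" where
  "wt \<gamma> = (\<Sum>c\<in>UNIV. lookup \<gamma> c * card {m. replaceable m c})"

lemma wt_add: "wt (\<alpha> + \<beta>) = wt \<alpha> + wt \<beta>"
  by (simp add: wt_def lookup_add sum.distrib ring_distribs)

lemma wt_unit: "wt (unit_exp j) = card {m. replaceable m j}"
proof -
  have "wt (unit_exp j) = (\<Sum>c\<in>UNIV. if j = c then card {m. replaceable m c} else 0)"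
    unfolding wt_def by (rule sum.cong) (auto simp: lookup_single when_def)
  then show ?thesis by simp
qed

lemma wt_replace:
  assumes "replaceable j l" "\<not> replaceable l j" "j \<in> active" "lookup \<alpha> j > 0"
  shows "wt (cdeg \<alpha>) < wt (cdeg (\<alpha> - unit_exp j + unit_exp l))"
proof -
  have "{m. replaceable m (cls j)} \<subset> {m. replaceable m (cls l)}"
    using assms(1,2) cls[of j] cls[of l] replaceable_trans by blast
  then have "wt (unit_exp (cls j)) < wt (unit_exp (cls l))"
    unfolding wt_unit by (simp add: psubset_card_mono)
  then show ?thesis using replaceable_active[OF assms(1,3)] assms(3)
    by (simp add: cdeg_remove[OF assms(4)] cdeg_add wt_add cdeg_single)
qed

lemma admissible_step:
  assumes U: "admissible i U" and U': "admissible i U'" and "U \<subset> U'"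
  shows "\<exists>U'' \<gamma>. admissible i U'' \<and> \<gamma> \<notin> cdegs i U \<and> cdegs i U'' = insert \<gamma> (cdegs i U) \<and> U'' \<subseteq> U'"
proof -
  let ?G = "cdegs i U' - cdegs i U"
  have ne: "?G \<noteq> {}" using assms(3) cdegs_mono[OF U' U] by blast
  have fin: "finite ?G" using finite_cdegs[OF U'] by simp
  \<comment> \<open>The fibre to be added: one of largest weight, so that a replacement stays in it or leads into \<open>U\<close>.\<close>
  obtain \<gamma> where \<gamma>: "\<gamma> \<in> ?G" "\<And>\<gamma>'. \<gamma>' \<in> ?G \<Longrightarrow> wt \<gamma>' \<le> wt \<gamma>"
  proof -
    have "Max (wt ` ?G) \<in> wt ` ?G" using ne fin by (intro Max_in) auto
    then obtain \<gamma> where "\<gamma> \<in> ?G" "wt \<gamma> = Max (wt ` ?G)" by auto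
    then show ?thesis using fin that by (metis Max_ge finite_imageI imageI)
  qed
  obtain \<alpha>0 where \<alpha>0: "\<alpha>0 \<in> U'" "\<alpha>0 \<notin> adeg_ge (Suc i) \<union> E" "cdeg \<alpha>0 = \<gamma>"
    using \<gamma>(1) by (auto simp: cdegs_def)
  have fib: "\<alpha> \<in> U'" "\<alpha> \<notin> adeg_ge (Suc i) \<union> E" "adeg \<alpha> = i" if "cdeg \<alpha> = \<gamma>" for \<alpha>
  proof -
    have eq: "adeg \<alpha> = adeg \<alpha>0" using that \<alpha>0(3) by (simp flip: tdeg_cdeg)
    show "\<alpha> \<in> U'" using admissible_saturated[OF U' \<alpha>0(1)] that \<alpha>0(3) by simp
    have "\<alpha> \<notin> E" using E_saturated[of \<alpha> \<alpha>0] that \<alpha>0 by auto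
    then show *: "\<alpha> \<notin> adeg_ge (Suc i) \<union> E" using \<alpha>0(2) eq by (auto simp: adeg_ge_def)
    show "adeg \<alpha> = i" using \<open>\<alpha> \<in> U'\<close> * U' by (auto simp: admissible_def adeg_ge_def subset_iff)
  qed
  define U'' where "U'' = U \<union> {\<alpha>. cdeg \<alpha> = \<gamma>}"
  have sub: "U'' \<subseteq> U'" using assms(3) fib(1) by (auto simp: U''_def)
  have single_step: "\<alpha> + unit_exp k \<in> U''" if "cdeg \<alpha> = \<gamma>" for \<alpha> k
  proof (cases "k \<in> active")
    case True
    then have "\<alpha> + unit_exp k \<in> adeg_ge (Suc i)" using fib(3)[OF that] by (simp add: adeg_ge_def adeg_add adeg_unit)
    then show ?thesis using U by (auto simp: U''_def admissible_def)
  next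
    case False
    then show ?thesis using that by (simp add: U''_def cdeg_add cdeg_single)
  qed
  have "\<alpha> + \<beta> \<in> U''" if "\<alpha> \<in> U''" for \<alpha> \<beta>
    using that
  proof (induction "tdeg \<beta>" arbitrary: \<alpha> \<beta>)
    case 0
    then have "\<beta> = 0" by (intro poly_mapping_eqI) (simp add: tdeg_def)
    then show ?case using 0 by simp
  next
    case (Suc d)
    have "\<exists>k. lookup \<beta> k > 0" using Suc.hyps(2) by (auto simp: tdeg_def intro: ccontr)
    then obtain k where "lookup \<beta> k > 0" by blast
    then have eq: "\<beta> - unit_exp k + unit_exp k = \<beta>" by simp
    have 1: "\<alpha> + unit_exp k \<in> U''"
      using Suc.prems single_step[of \<alpha> k] U upsetD[of U \<alpha> "unit_exp k"] by (auto simp: U''_def admissible_def)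
    have "d = tdeg (\<beta> - unit_exp k)" using arg_cong[OF eq, of tdeg] Suc.hyps(2) by (simp add: tdeg_add)
    from Suc.hyps(1)[OF this 1] have "\<alpha> + ((\<beta> - unit_exp k) + unit_exp k) \<in> U''" by (simp add: add_ac)
    then show ?case by (simp only: eq)
  qed
  then have "upset U''" by (simp add: upset_def)
  moreover have "\<alpha> - unit_exp j \<in> U''" if "\<alpha> \<in> U''" "j \<notin> active" "lookup \<alpha> j > 0" for \<alpha> j
    using that U cdeg_remove[OF that(3)] by (auto simp: U''_def admissible_def cdeg_single)
  moreover have "\<alpha> - unit_exp j + unit_exp l \<in> U''"
    if \<alpha>: "\<alpha> \<in> U''" and r: "replaceable j l" and pos: "lookup \<alpha> j > 0" for \<alpha> j l
  proof (cases "\<alpha> \<in> U")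
    case True
    then show ?thesis using U r pos by (auto simp: U''_def admissible_def)
  next
    case False
    then have c: "cdeg \<alpha> = \<gamma>" using \<alpha> by (simp add: U''_def)
    show ?thesis
    proof (cases "j \<in> active")
      case j: False
      have "cdeg (\<alpha> - unit_exp j) = \<gamma>" using cdeg_remove[OF pos] c j by (simp add: cdeg_single)
      then show ?thesis by (rule single_step)
    next
      case j: True
      show ?thesis
      proof (cases "replaceable l j")
        case True
        then have "cls j = cls l" using r by (simp add: cls_eq_iff)
        then show ?thesis using cdeg_replace[OF _ pos] c by (simp add: U''_def)
      next
        case False
        let ?\<alpha> = "\<alpha> - unit_exp j + unit_exp l"
        have "wt \<gamma> < wt (cdeg ?\<alpha>)" using wt_replace[OF r False j pos] c by simp
        then have "cdeg ?\<alpha> \<notin> ?G" using \<gamma>(2) by (meson leD)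
        moreover have "?\<alpha> \<in> U'" using U' fib(1)[OF c] r pos by (auto simp: admissible_def)
        ultimately have "?\<alpha> \<in> U" using cdegs_iff[OF U] cdegs_iff[OF U'] by blast
        then show ?thesis by (simp add: U''_def)
      qed
    qed
  qed
  moreover have "adeg_ge (Suc i) \<union> E \<subseteq> U''" "U'' \<subseteq> adeg_ge i \<union> E"
    using U U' sub by (auto simp: U''_def admissible_def)
  ultimately have "admissible i U''" unfolding admissible_def by blast
  moreover have "cdegs i U'' = insert \<gamma> (cdegs i U)"
    using fib(2) \<alpha>0(3) by (auto simp: cdegs_def U''_def)
  ultimately show ?thesis using sub \<gamma>(1) by blast
qed

lemma cdegs_bot: "cdegs i (adeg_ge (Suc i) \<union> E) = {}"
  by (simp add: cdegs_def)

lemma cdegs_top: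
  "cdegs i (adeg_ge i \<union> E) = {\<gamma>. keys \<gamma> \<subseteq> cls ` active \<and> tdeg \<gamma> = i \<and> \<gamma> \<notin> E}"
proof (intro equalityI subsetI)
  fix \<gamma> assume "\<gamma> \<in> cdegs i (adeg_ge i \<union> E)"
  then obtain \<alpha> where \<alpha>: "\<gamma> = cdeg \<alpha>" "adeg \<alpha> = i" "\<alpha> \<notin> E"
    by (force simp: cdegs_def adeg_ge_def not_le less_Suc_eq_le)
  have "c \<in> cls ` active" if "c \<in> keys (cdeg \<alpha>)" for c
  proof -
    have "{j\<in>active. cls j = c} \<noteq> {}" using that by (auto simp: in_keys_iff lookup_cdeg)
    then show ?thesis by auto
  qed
  moreover have "\<gamma> \<notin> E" using E_saturated[of \<gamma> \<alpha>] \<alpha> by (auto simp: cdeg_cdeg)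
  ultimately show "\<gamma> \<in> {\<gamma>. keys \<gamma> \<subseteq> cls ` active \<and> tdeg \<gamma> = i \<and> \<gamma> \<notin> E}"
    using \<alpha> by (auto simp: tdeg_cdeg)
next
  fix \<gamma> assume "\<gamma> \<in> {\<gamma>. keys \<gamma> \<subseteq> cls ` active \<and> tdeg \<gamma> = i \<and> \<gamma> \<notin> E}"
  then have k: "keys \<gamma> \<subseteq> cls ` active" and t: "tdeg \<gamma> = i" and n: "\<gamma> \<notin> E" by auto
  have z: "lookup \<gamma> c = 0" if "c \<notin> cls ` active" for c using k that by (auto simp: in_keys_iff)
  have "cdeg \<gamma> = \<gamma>"
  proof (rule poly_mapping_eqI)
    fix c
    show "lookup (cdeg \<gamma>) c = lookup \<gamma> c"
    proof (cases "c \<in> cls ` active")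
      case True
      then have c: "c \<in> {j\<in>active. cls j = c}" by (auto simp: cls_active)
      have "lookup \<gamma> j = 0" if "j \<in> {j\<in>active. cls j = c} - {c}" for j
        by (rule z) (use that in auto)
      then have "(\<Sum>j\<in>{j\<in>active. cls j = c}. lookup \<gamma> j) = (\<Sum>j\<in>{c}. lookup \<gamma> j)"
        by (intro sum.mono_neutral_right) (use c in auto)
      then show ?thesis by (simp add: lookup_cdeg)
    next
      case False
      then have "{j\<in>active. cls j = c} = {}" by auto
      then have "lookup (cdeg \<gamma>) c = 0" unfolding lookup_cdeg by (simp only: sum.empty)
      then show ?thesis using z[OF False] by simp
    qed
  qed
  then have "adeg \<gamma> = i" using t by (metis tdeg_cdeg)
  then have "\<gamma> \<in> adeg_ge i \<union> E - (adeg_ge (Suc i) \<union> E)" using n by (simp add: adeg_ge_def)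
  then show "\<gamma> \<in> cdegs i (adeg_ge i \<union> E)"
    using \<open>cdeg \<gamma> = \<gamma>\<close> unfolding cdegs_def by (metis imageI)
qed

end

section \<open>Monomial ideals and their derivations\<close>

lemma B_ring_simps [simp]:
  "carrier B_ring = UNIV" "f \<oplus>\<^bsub>B_ring\<^esub> g = f + g" "f \<otimes>\<^bsub>B_ring\<^esub> g = f * g"
  "\<zero>\<^bsub>B_ring\<^esub> = 0" "\<one>\<^bsub>B_ring\<^esub> = 1"
  by (simp_all add: ring_of_type_algebra_def)

lemma ideal_B_ring_iff:
  "ideal K B_ring \<longleftrightarrow> 0 \<in> K \<and> (\<forall>f\<in>K. \<forall>g\<in>K. f + g \<in> K) \<and> (\<forall>f\<in>K. \<forall>g. g * f \<in> K)"
    (is "_ \<longleftrightarrow> ?r")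
proof
  assume "ideal K B_ring"
  then interpret ideal K B_ring .
  have "0 \<in> K" using additive_subgroup.zero_closed[OF is_additive_subgroup] by simp
  moreover have "f + g \<in> K" if "f \<in> K" "g \<in> K" for f g
    using additive_subgroup.a_closed[OF is_additive_subgroup that] by simp
  moreover have "g * f \<in> K" if "f \<in> K" for f g using I_l_closed[OF that, of g] by simp
  ultimately show ?r by blast
next
  assume r: ?r
  interpret R: ring "B_ring :: ('a, 'b) mpoly ring" by (rule ring_from_type_algebra)
  have neg: "- f \<in> K" if "f \<in> K" for f using r that by (metis mult_minus1)
  show "ideal K B_ring"
  proof (rule idealI)
    show "subgroup K (add_monoid B_ring)"
    proof (rule R.add.subgroupI)
      fix f assume "f \<in> K"
      moreover have "\<ominus>\<^bsub>B_ring\<^esub> f = - f"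
        by (rule R.minus_equality) simp_all
      ultimately show "\<ominus>\<^bsub>B_ring\<^esub> f \<in> K" using neg by simp
    qed (use r in auto)
  qed (use r in \<open>auto simp: R.ring_axioms mult.commute\<close>)
qed

text \<open>The span of the monomials with exponents in \<open>U\<close>.\<close>

definition mspan :: "('n::finite \<Rightarrow>\<^sub>0 nat) set \<Rightarrow> ('n, 'k::field) mpoly set" where
  "mspan U = {f. keys f \<subseteq> U}"

lemma mspan_0: "0 \<in> mspan U"
  by (simp add: mspan_def)

lemma mspan_add: "f \<in> mspan U \<Longrightarrow> g \<in> mspan U \<Longrightarrow> f + g \<in> mspan U"
  using Poly_Mapping.keys_add[of f g] by (auto simp: mspan_def)

lemma mspan_diff: "f \<in> mspan U \<Longrightarrow> g \<in> mspan U \<Longrightarrow> f - g \<in> mspan U" for f g :: "('n::finite, 'k::field) mpoly"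
  using mspan_add[of f U "- g"] by (simp add: mspan_def)

lemma mspan_nonempty: "mspan U \<noteq> {}"
  using mspan_0 by blast

lemma mspan_mult:
  assumes "\<And>\<alpha> \<beta>. \<alpha> \<in> U \<Longrightarrow> \<beta> \<in> V \<Longrightarrow> \<alpha> + \<beta> \<in> W" "f \<in> mspan U" "g \<in> mspan V"
  shows "f * g \<in> mspan W"
  using Poly_Mapping.keys_mult[of f g] assms by (auto simp: mspan_def subset_iff)

lemma mspan_upset_mult: "upset U \<Longrightarrow> f \<in> mspan U \<Longrightarrow> g * f \<in> mspan U"
  by (rule mspan_mult[of UNIV U]) (subst add.commute, auto simp: mspan_def upsetD)

lemma ideal_mspan: "upset U \<Longrightarrow> ideal (mspan U) B_ring"
  by (simp add: ideal_B_ring_iff mspan_0 mspan_add mspan_upset_mult)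

lemma mspan_sum: "(\<And>a. a \<in> A \<Longrightarrow> f a \<in> mspan U) \<Longrightarrow> sum f A \<in> mspan U"
  by (induction A rule: infinite_finite_induct) (auto intro: mspan_add mspan_0)

lemma mspan_mono: "U \<subseteq> V \<Longrightarrow> mspan U \<subseteq> mspan V"
  by (auto simp: mspan_def)

lemma xmono_in_mspan [simp]: "xmono \<alpha> \<in> mspan U \<longleftrightarrow> \<alpha> \<in> U"
  by (simp add: mspan_def xmono_def)

lemma mspan_subset_iff: "mspan U \<subseteq> (mspan V :: ('n::finite, 'k::field) mpoly set) \<longleftrightarrow> U \<subseteq> V"
proof
  assume sub: "mspan U \<subseteq> (mspan V :: ('n, 'k) mpoly set)"
  show "U \<subseteq> V"
  proof
    fix \<alpha> assume "\<alpha> \<in> U"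
    then have "(xmono \<alpha> :: ('n, 'k) mpoly) \<in> mspan U" by simp
    then have "(xmono \<alpha> :: ('n, 'k) mpoly) \<in> mspan V" using sub by blast
    then show "\<alpha> \<in> V" by simp
  qed
qed (rule mspan_mono)

lemma mpoly_sum_single:
  fixes f :: "('n::finite, 'k::field) mpoly"
  shows "f = (\<Sum>\<alpha>\<in>keys f. Poly_Mapping.single \<alpha> (lookup f \<alpha>))"
  by (rule poly_mapping_eqI) (auto simp: lookup_sum lookup_single when_def in_keys_iff)

lemma mspan_decompose:
  fixes f :: "('n::finite, 'k::field) mpoly"
  assumes "f \<in> mspan (U \<union> V)"
  obtains g h where "f = g + h" "g \<in> mspan U" "h \<in> mspan V"
proof -
  define g where "g = (\<Sum>\<alpha>\<in>keys f \<inter> U. Poly_Mapping.single \<alpha> (lookup f \<alpha>))"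
  define h where "h = (\<Sum>\<alpha>\<in>keys f - U. Poly_Mapping.single \<alpha> (lookup f \<alpha>))"
  have "f = g + h" unfolding g_def h_def
    by (subst mpoly_sum_single) (simp add: sum.Int_Diff[of "keys f" _ U])
  moreover have "g \<in> mspan U" unfolding g_def by (rule mspan_sum) (auto simp: mspan_def)
  moreover have "h \<in> mspan V" unfolding h_def
    by (rule mspan_sum) (use assms in \<open>auto simp: mspan_def\<close>)
  ultimately show ?thesis by (rule that)
qed

lemma single_eq_const_mult: "Poly_Mapping.single \<alpha> c = const c * xmono \<alpha>"
  by (simp add: const_def xmono_def mult_single)

lemma xmono_add: "xmono (\<alpha> + \<beta>) = xmono \<alpha> * xmono \<beta>"
  by (simp add: xmono_def mult_single)

lemma xmono_0: "xmono 0 = 1"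
  by (simp add: xmono_def)

lemma const_0: "const 0 = 0" and const_1: "const 1 = 1"
  and const_add: "const (a + b) = const a + const b"
  by (simp_all add: const_def single_add mult_single)

lemma mspan_subset_ideal:
  assumes K: "ideal K B_ring" and "\<And>\<alpha>. \<alpha> \<in> U \<Longrightarrow> xmono \<alpha> \<in> K"
  shows "mspan U \<subseteq> K"
proof
  fix f :: "('a, 'b) mpoly" assume f: "f \<in> mspan U"
  have "(\<Sum>\<alpha>\<in>A. Poly_Mapping.single \<alpha> (lookup f \<alpha>)) \<in> K" if "finite A" "A \<subseteq> U" for A
    using that
    by (induction A) (use K assms(2) in \<open>auto simp: ideal_B_ring_iff single_eq_const_mult\<close>)
  from this[of "keys f"] f show "f \<in> K" by (simp add: mspan_def flip: mpoly_sum_single)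
qed

lemma Idl_xmono: "Idl\<^bsub>B_ring\<^esub> (xmono ` A) = mspan {\<alpha> + \<beta> | \<alpha> \<beta>. \<alpha> \<in> A}"
proof
  interpret R: ring "B_ring :: ('a, 'b) mpoly ring" by (rule ring_from_type_algebra)
  let ?U = "{\<alpha> + \<beta> | \<alpha> \<beta>. \<alpha> \<in> A}"
  have "upset ?U" unfolding upset_def by (force simp: add.assoc)
  moreover have "\<alpha> \<in> ?U" if "\<alpha> \<in> A" for \<alpha> using that by (intro CollectI exI[of _ \<alpha>] exI[of _ 0]) simp
  ultimately show "Idl\<^bsub>B_ring\<^esub> (xmono ` A) \<subseteq> (mspan ?U :: ('a, 'b) mpoly set)"
    by (intro R.genideal_minimal ideal_mspan) auto
  have id: "ideal (Idl\<^bsub>B_ring\<^esub> (xmono ` A)) (B_ring :: ('a, 'b) mpoly ring)"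
    by (intro R.genideal_ideal) simp
  have "xmono \<alpha> \<in> Idl\<^bsub>B_ring\<^esub> (xmono ` A :: ('a, 'b) mpoly set)" if "\<alpha> \<in> A" for \<alpha>
    using R.genideal_self[of "xmono ` A"] that by auto
  then have "xmono (\<alpha> + \<beta>) \<in> Idl\<^bsub>B_ring\<^esub> (xmono ` A :: ('a, 'b) mpoly set)" if "\<alpha> \<in> A" for \<alpha> \<beta>
    using id that by (simp add: ideal_B_ring_iff xmono_add mult.commute)
  then show "(mspan ?U :: ('a, 'b) mpoly set) \<subseteq> Idl\<^bsub>B_ring\<^esub> (xmono ` A)"
    by (intro mspan_subset_ideal[OF id]) auto
qed

lemma lookup_xmono_mult_add: "lookup (xmono \<alpha> * f) (\<alpha> + \<beta>) = lookup f \<beta>"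
proof -
  have "xmono \<alpha> * f = (\<Sum>\<gamma>\<in>keys f. Poly_Mapping.single (\<alpha> + \<gamma>) (lookup f \<gamma>))"
    by (subst (1) mpoly_sum_single) (simp add: sum_distrib_left xmono_def mult_single)
  then show ?thesis by (simp add: lookup_sum lookup_single when_def in_keys_iff)
qed

lemma keys_xmono_mult: "keys (xmono \<alpha> * f) \<subseteq> (\<lambda>\<beta>. \<alpha> + \<beta>) ` keys f"
  using Poly_Mapping.keys_mult[of "xmono \<alpha>" f] by (auto simp: xmono_def split: if_splits)

lemma lookup_const_mult: "lookup (const c * f) \<alpha> = c * lookup f \<alpha>"
proof -
  have "const c * f = (\<Sum>\<gamma>\<in>keys f. Poly_Mapping.single \<gamma> (c * lookup f \<gamma>))"
    by (subst (1) mpoly_sum_single) (simp add: sum_distrib_left const_def mult_single)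
  then show ?thesis by (simp add: lookup_sum lookup_single when_def in_keys_iff)
qed

lemma lookup_partial: "lookup (partial i f) \<alpha> = of_nat (lookup \<alpha> i + 1) * lookup f (\<alpha> + unit_exp i)"
proof -
  have *: "(of_nat (lookup \<beta> i) * lookup f \<beta> when \<beta> - unit_exp i = \<alpha>) =
      (if \<beta> = \<alpha> + unit_exp i then of_nat (lookup \<alpha> i + 1) * lookup f \<beta> else 0)" for \<beta>
  proof (cases "lookup \<beta> i > 0")
    case True
    then show ?thesis
      using exp_remove_add[OF True] by (auto simp: when_def exp_add_remove lookup_add)
  next
    case False
    then have "\<beta> \<noteq> \<alpha> + unit_exp i" by (auto simp: lookup_add)
    then show ?thesis using False by simp
  qed
  show ?thesis
    unfolding partial_def by (auto simp: lookup_sum lookup_single * in_keys_iff)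
qed

lemma partial_single:
  "partial i (Poly_Mapping.single \<alpha> c) =
     Poly_Mapping.single (\<alpha> - unit_exp i) (of_nat (lookup \<alpha> i) * c)"
  by (cases "c = 0") (auto simp: partial_def)

lemma mpoly_induct [case_names single add]:
  fixes f :: "('n::finite, 'k::field) mpoly"
  assumes "\<And>\<alpha> c. P (Poly_Mapping.single \<alpha> c)" "\<And>f g. P f \<Longrightarrow> P g \<Longrightarrow> P (f + g)"
  shows "P f"
proof -
  have 0: "P 0" using assms(1)[of 0 0] by simp
  have "P (\<Sum>\<alpha>\<in>A. Poly_Mapping.single \<alpha> (lookup f \<alpha>))" if "finite A" for A
    using that by (induction A) (auto simp: 0 assms)
  from this[of "keys f"] show ?thesis by (simp flip: mpoly_sum_single)
qed

lemma partial_derivation: "partial i \<in> derivations"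
proof -
  have add: "partial i (f + g) = partial i f + partial i g" for f g :: "('a, 'b) mpoly"
    by (rule poly_mapping_eqI) (simp add: lookup_partial lookup_add ring_distribs)
  have smult: "partial i (const c * f) = const c * partial i f" for c and f :: "('a, 'b) mpoly"
    by (rule poly_mapping_eqI) (simp add: lookup_partial lookup_const_mult)
  have single: "partial i (Poly_Mapping.single \<alpha> a * Poly_Mapping.single \<beta> b) =
      partial i (Poly_Mapping.single \<alpha> a) * Poly_Mapping.single \<beta> b +
      Poly_Mapping.single \<alpha> a * partial i (Poly_Mapping.single \<beta> b)" for \<alpha> \<beta> and a b :: 'b
  proof -
    have 1: "\<alpha> - unit_exp i + \<beta> = \<alpha> + \<beta> - unit_exp i" if "lookup \<alpha> i > 0" for \<alpha> \<beta> :: "'a \<Rightarrow>\<^sub>0 nat"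
      using that by (intro poly_mapping_eqI) (auto simp: lookup_add lookup_minus lookup_single when_def)
    have "Poly_Mapping.single (\<alpha> - unit_exp i + \<beta>) (of_nat (lookup \<alpha> i) * (a * b)) =
        Poly_Mapping.single (\<alpha> + \<beta> - unit_exp i) (of_nat (lookup \<alpha> i) * (a * b))"
      using 1[of \<alpha> \<beta>] by (cases "lookup \<alpha> i = 0") auto
    moreover have "Poly_Mapping.single (\<alpha> + (\<beta> - unit_exp i)) (of_nat (lookup \<beta> i) * (a * b)) =
        Poly_Mapping.single (\<alpha> + \<beta> - unit_exp i) (of_nat (lookup \<beta> i) * (a * b))"
      using 1[of \<beta> \<alpha>] by (cases "lookup \<beta> i = 0") (auto simp: add.commute)
    ultimately show ?thesis
      by (simp add: partial_single mult_single lookup_add single_add ring_distribs mult.assoc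
          mult.left_commute)
  qed
  have "partial i (f * Poly_Mapping.single \<beta> b) =
      partial i f * Poly_Mapping.single \<beta> b + f * partial i (Poly_Mapping.single \<beta> b)"
    for f :: "('a, 'b) mpoly" and \<beta> b
    by (induction f rule: mpoly_induct) (simp_all add: single add ring_distribs)
  then have "partial i (f * g) = partial i f * g + f * partial i g" for f g :: "('a, 'b) mpoly"
    by (induction g rule: mpoly_induct) (simp_all add: add ring_distribs)
  then show ?thesis using add smult by (simp add: derivations_def)
qed

lemma derivations_mult: "\<delta> \<in> derivations \<Longrightarrow> (\<lambda>f. g * \<delta> f) \<in> derivations"
  by (auto simp: derivations_def ring_distribs mult_ac)

context
  fixes \<delta> :: "('n::finite, 'k::field) mpoly \<Rightarrow> ('n, 'k) mpoly"
  assumes d: "\<delta> \<in> derivations"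
begin

lemma derivation_add: "\<delta> (f + g) = \<delta> f + \<delta> g"
  and derivation_const: "\<delta> (const c * f) = const c * \<delta> f"
  and derivation_mult: "\<delta> (f * g) = \<delta> f * g + f * \<delta> g"
  using d by (auto simp: derivations_def)

lemma derivation_0: "\<delta> 0 = 0"
  using derivation_add[of 0 0] by simp

text \<open>A derivation is determined by its values on the variables, \<open>\<delta> = \<Sum>\<^sub>j \<delta>(x\<^sub>j) \<partial>\<^sub>j\<close>, here on monomials. Where
the exponent \<open>\<alpha> - e\<^sub>j\<close> truncates, the coefficient vanishes.\<close>

lemma derivation_xmono:
  "\<delta> (xmono \<alpha>) = (\<Sum>j\<in>UNIV. const (of_nat (lookup \<alpha> j)) * (xmono (\<alpha> - unit_exp j) * \<delta> (var j)))"
proof (induction "tdeg \<alpha>" arbitrary: \<alpha>)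
  case 0
  then have "\<alpha> = 0" by (intro poly_mapping_eqI) (simp add: tdeg_def)
  moreover have "\<delta> 1 = 0" using derivation_mult[of 1 1] by simp
  ultimately show ?case by (simp add: xmono_0 const_0)
next
  case (Suc d)
  have "\<exists>k. lookup \<alpha> k > 0" using Suc.hyps(2) by (auto simp: tdeg_def intro: ccontr)
  then obtain k where k: "lookup \<alpha> k > 0" by blast
  define \<beta> where "\<beta> = \<alpha> - unit_exp k"
  have eq: "\<alpha> = \<beta> + unit_exp k" using k by (simp add: \<beta>_def)
  have "d = tdeg \<beta>" using Suc.hyps(2) by (simp add: eq tdeg_add)
  have summand: "const (of_nat (lookup \<alpha> j)) * (xmono (\<alpha> - unit_exp j) * \<delta> (var j)) =
      const (of_nat (lookup \<beta> j)) * (xmono (\<beta> - unit_exp j) * \<delta> (var j)) * var k +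
      (if j = k then xmono \<beta> * \<delta> (var k) else 0)" for j
  proof -
    have "\<alpha> - unit_exp j = \<beta> - unit_exp j + unit_exp k" if "lookup \<beta> j > 0"
      using that by (intro poly_mapping_eqI) (auto simp: eq lookup_add lookup_minus lookup_single when_def)
    then have 1: "const (of_nat (lookup \<beta> j)) * xmono (\<alpha> - unit_exp j) =
        const (of_nat (lookup \<beta> j)) * (xmono (\<beta> - unit_exp j) * var k)"
      by (cases "lookup \<beta> j = 0") (auto simp: const_0 var_def xmono_add)
    have 2: "const (of_nat (lookup \<alpha> j)) = const (of_nat (lookup \<beta> j)) + (if j = k then 1 else 0)"
      by (auto simp: eq lookup_add lookup_single const_add const_1 const_0)
    have 3: "\<alpha> - unit_exp k = \<beta>" by (simp add: \<beta>_def)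
    have "const (of_nat (lookup \<alpha> j)) * (xmono (\<alpha> - unit_exp j) * \<delta> (var j)) =
        (const (of_nat (lookup \<beta> j)) * xmono (\<alpha> - unit_exp j)) * \<delta> (var j) +
        (if j = k then xmono \<beta> * \<delta> (var k) else 0)"
      unfolding 2 using 3 by (simp add: ring_distribs mult.assoc)
    then show ?thesis unfolding 1 by (simp add: mult_ac)
  qed
  have "\<delta> (xmono \<alpha>) = \<delta> (xmono \<beta> * var k)" by (simp add: eq xmono_add var_def)
  also have "\<dots> = \<delta> (xmono \<beta>) * var k + xmono \<beta> * \<delta> (var k)" by (rule derivation_mult)
  also have "\<dots> = (\<Sum>j\<in>UNIV. const (of_nat (lookup \<alpha> j)) * (xmono (\<alpha> - unit_exp j) * \<delta> (var j)))"
    unfolding Suc.hyps(1)[OF \<open>d = tdeg \<beta>\<close>] summand by (simp add: sum.distrib sum_distrib_right)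
  finally show ?case .
qed

lemma derivation_mspan:
  assumes U: "\<And>\<alpha> j \<mu>. \<alpha> \<in> U \<Longrightarrow> lookup \<alpha> j > 0 \<Longrightarrow> \<mu> \<in> keys (\<delta> (var j)) \<Longrightarrow> \<alpha> - unit_exp j + \<mu> \<in> V"
    and "f \<in> mspan U"
  shows "\<delta> f \<in> mspan V"
proof -
  have c: "const c * g \<in> mspan V" if "g \<in> mspan V" for c and g :: "('n, 'k) mpoly"
    using that by (auto simp: mspan_def in_keys_iff lookup_const_mult)
  have "\<delta> (xmono \<alpha>) \<in> mspan V" if "\<alpha> \<in> U" for \<alpha>
    unfolding derivation_xmono
  proof (rule mspan_sum)
    fix j
    show "const (of_nat (lookup \<alpha> j)) * (xmono (\<alpha> - unit_exp j) * \<delta> (var j)) \<in> mspan V"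
    proof (cases "lookup \<alpha> j = 0")
      case False
      then have "xmono (\<alpha> - unit_exp j) * \<delta> (var j) \<in> mspan V"
        using keys_xmono_mult[of "\<alpha> - unit_exp j" "\<delta> (var j)"] U[OF that] unfolding mspan_def by blast
      then show ?thesis by (rule c)
    qed (simp add: const_0 mspan_0)
  qed
  then have x: "\<And>\<alpha>. \<alpha> \<in> U \<Longrightarrow> \<delta> (xmono \<alpha>) \<in> mspan V" .
  have "\<delta> (\<Sum>\<alpha>\<in>A. Poly_Mapping.single \<alpha> (lookup f \<alpha>)) \<in> mspan V" if "finite A" "A \<subseteq> U" for A
    using that by (induction A)
      (auto simp: x derivation_0 mspan_0 derivation_add single_eq_const_mult derivation_const intro!: mspan_add c)
  from this[of "keys f"] assms(2) show ?thesis by (simp add: mspan_def flip: mpoly_sum_single)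
qed

end

context monomial_upset
begin

text \<open>If \<open>\<delta> = \<Sum>\<^sub>j \<delta>(x\<^sub>j) \<partial>\<^sub>j\<close> preserves \<open>I\<close>, then so does each term \<open>x\<^sup>\<mu> \<partial>\<^sub>j\<close> of \<open>\<delta>\<close> with \<open>\<mu>\<^sub>j = 0\<close>: it lowers the degree in \<open>x\<^sub>j\<close>
and so cannot cancel against the terms involving another \<open>\<partial>\<^sub>l\<close>. Terms with \<open>\<mu>\<^sub>j > 0\<close> are multiples of the
Euler derivation \<open>x\<^sub>j \<partial>\<^sub>j\<close> and preserve every monomial ideal.\<close>

lemma T_B_exponent:
  fixes \<delta> :: "('n, 'k::{field_char_0}) mpoly \<Rightarrow> ('n, 'k) mpoly"
  assumes \<delta>: "\<delta> \<in> T_B (mspan E)" and \<mu>: "\<mu> \<in> keys (\<delta> (var j))" "lookup \<mu> j = 0"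
    and \<beta>: "\<beta> \<in> E" "lookup \<beta> j > 0"
  shows "\<beta> - unit_exp j + \<mu> \<in> E"
proof -
  have d: "\<delta> \<in> derivations" and "\<delta> (xmono \<beta>) \<in> mspan E" using \<delta> \<beta>(1) by (auto simp: T_B_def)
  let ?\<kappa> = "\<beta> - unit_exp j + \<mu>"
  have "lookup (\<delta> (xmono \<beta>)) ?\<kappa> =
      (\<Sum>l\<in>UNIV. of_nat (lookup \<beta> l) * lookup (xmono (\<beta> - unit_exp l) * \<delta> (var l)) ?\<kappa>)"
    by (simp add: derivation_xmono[OF d] lookup_sum lookup_const_mult)
  also have "\<dots> = (\<Sum>l\<in>{j}. of_nat (lookup \<beta> l) * lookup (xmono (\<beta> - unit_exp l) * \<delta> (var l)) ?\<kappa>)"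
  proof (rule sum.mono_neutral_right; (rule ballI)?)
    fix l assume "l \<in> UNIV - {j}"
    then have "lookup ?\<kappa> j < lookup (\<beta> - unit_exp l) j"
      using \<mu>(2) \<beta>(2) by (simp add: lookup_add lookup_minus lookup_single when_def)
    then have "?\<kappa> \<noteq> \<beta> - unit_exp l + \<nu>" for \<nu> by (metis lookup_add not_add_less1)
    then have "?\<kappa> \<notin> (\<lambda>\<nu>. \<beta> - unit_exp l + \<nu>) ` keys (\<delta> (var l))" by blast
    then have "?\<kappa> \<notin> keys (xmono (\<beta> - unit_exp l) * \<delta> (var l))" using keys_xmono_mult by blast
    then show "of_nat (lookup \<beta> l) * lookup (xmono (\<beta> - unit_exp l) * \<delta> (var l)) ?\<kappa> = 0"
      by (simp add: in_keys_iff)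
  qed simp_all
  also have "\<dots> = of_nat (lookup \<beta> j) * lookup (\<delta> (var j)) \<mu>" by (simp add: lookup_xmono_mult_add)
  also have "\<dots> \<noteq> 0" using \<beta>(2) \<mu>(1) by (simp add: in_keys_iff)
  finally show ?thesis using \<open>\<delta> (xmono \<beta>) \<in> mspan E\<close> by (auto simp: mspan_def in_keys_iff)
qed

lemma remove_inactive:
  assumes rem: "\<And>\<alpha> j. \<alpha> \<in> W \<Longrightarrow> j \<notin> active \<Longrightarrow> lookup \<alpha> j > 0 \<Longrightarrow> \<alpha> - unit_exp j \<in> W"
    and "\<kappa> + \<rho> \<in> W" "adeg \<rho> = 0"
  shows "\<kappa> \<in> W"
  using assms(2,3)
proof (induction "tdeg \<rho>" arbitrary: \<rho>)
  case 0
  then have "\<rho> = 0" by (intro poly_mapping_eqI) (simp add: tdeg_def)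
  then show ?case using 0 by simp
next
  case (Suc d)
  have "\<exists>k. lookup \<rho> k > 0" using Suc.hyps(2) by (auto simp: tdeg_def intro: ccontr)
  then obtain k where k: "lookup \<rho> k > 0" by blast
  then have inact: "k \<notin> active" using Suc.prems(2) by (auto simp: adeg_def)
  have eq: "\<rho> - unit_exp k + unit_exp k = \<rho>" using k by simp
  have "d = tdeg (\<rho> - unit_exp k)" using arg_cong[OF eq, of tdeg] Suc.hyps(2) by (simp add: tdeg_add)
  moreover have "\<kappa> + (\<rho> - unit_exp k) \<in> W"
  proof -
    have "\<kappa> + \<rho> - unit_exp k = \<kappa> + (\<rho> - unit_exp k)"
      using k by (intro poly_mapping_eqI) (auto simp: lookup_add lookup_minus lookup_single when_def)
    then show ?thesis using rem[OF Suc.prems(1) inact] k by (simp add: lookup_add)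
  qed
  moreover have "adeg (\<rho> - unit_exp k) = 0" using Suc.prems(2) adeg_remove[OF k] by simp
  ultimately show ?case by (rule Suc.hyps(1))
qed

text \<open>The combinatorial core of stability. For active \<open>j\<close>, the monomial \<open>x\<^sup>\<mu>\<close> involves an active variable, since
otherwise \<open>\<partial>\<^sub>j\<close> would preserve \<open>I\<close>. If its active degree is at least two, then \<open>x\<^sup>\<mu> \<partial>\<^sub>j\<close> maps \<open>J\<^sup>i\<close> to
\<open>J\<^sup>i\<^sup>+\<^sup>1\<close>; if it is one, then \<open>x\<^sup>\<mu> \<partial>\<^sub>j\<close> is a multiple of a replacement \<open>x\<^sub>l \<partial>\<^sub>j\<close>.\<close>

lemma admissible_shift:
  assumes U: "admissible i U" and \<mu>: "\<And>\<beta>. \<beta> \<in> E \<Longrightarrow> lookup \<beta> j > 0 \<Longrightarrow> \<beta> - unit_exp j + \<mu> \<in> E"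
    and \<alpha>: "\<alpha> \<in> U" "lookup \<alpha> j > 0"
  shows "\<alpha> - unit_exp j + \<mu> \<in> U"
proof (cases "j \<in> active")
  case False
  then have "\<alpha> - unit_exp j \<in> U" using U \<alpha> by (auto simp: admissible_def)
  then show ?thesis using U upsetD by (auto simp: admissible_def)
next
  case j: True
  have "adeg \<mu> \<noteq> 0"
  proof
    assume z: "adeg \<mu> = 0"
    have "\<beta> - unit_exp j \<in> E" if "\<beta> \<in> E" "lookup \<beta> j > 0" for \<beta>
      using remove_inactive[OF E_remove \<mu>[OF that] z] by blast
    then show False using j by (auto simp: active_def)
  qed
  show ?thesis
  proof (cases "adeg \<mu> = 1")
    case True
    then have "\<exists>l\<in>active. lookup \<mu> l > 0" by (auto simp: adeg_def intro: ccontr)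
    then obtain l where l: "l \<in> active" "lookup \<mu> l > 0" by blast
    define \<rho> where "\<rho> = \<mu> - unit_exp l"
    have eq: "\<mu> = unit_exp l + \<rho>" using l(2) by (simp add: \<rho>_def add.commute)
    have z: "adeg \<rho> = 0" using True l by (simp add: eq adeg_add adeg_unit)
    have "replaceable j l"
      unfolding replaceable_def
    proof (intro ballI impI)
      fix \<beta> assume "\<beta> \<in> E" "lookup \<beta> j > 0"
      from \<mu>[OF this] have "\<beta> - unit_exp j + unit_exp l + \<rho> \<in> E" by (simp add: eq add.assoc)
      from remove_inactive[OF E_remove this z] show "\<beta> - unit_exp j + unit_exp l \<in> E" by blast
    qed
    then have "\<alpha> - unit_exp j + unit_exp l \<in> U" using U \<alpha> by (auto simp: admissible_def)
    then have "\<alpha> - unit_exp j + unit_exp l + \<rho> \<in> U" using U upsetD by (auto simp: admissible_def)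
    then show ?thesis by (simp add: eq add.assoc)
  next
    case False
    then have two: "adeg \<mu> \<ge> 2" using \<open>adeg \<mu> \<noteq> 0\<close> by simp
    have "\<alpha> \<in> E \<or> \<alpha> \<in> adeg_ge i" using U \<alpha> by (auto simp: admissible_def)
    then have "\<alpha> - unit_exp j + \<mu> \<in> adeg_ge (Suc i) \<union> E"
    proof
      assume "\<alpha> \<in> adeg_ge i"
      then have "\<alpha> - unit_exp j + \<mu> \<in> adeg_ge (Suc i)"
        using adeg_remove[OF \<alpha>(2)] j two by (simp add: adeg_ge_def adeg_add)
      then show ?thesis by simp
    qed (use \<mu> \<alpha>(2) in simp)
    then show ?thesis using U by (auto simp: admissible_def)
  qed
qed

lemma admissible_T_B_stable:
  fixes \<delta> :: "('n, 'k::{field_char_0}) mpoly \<Rightarrow> ('n, 'k) mpoly"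
  assumes U: "admissible i U" and \<delta>: "\<delta> \<in> T_B (mspan E)" and f: "f \<in> mspan U"
  shows "\<delta> f \<in> mspan U"
proof (rule derivation_mspan[OF _ _ f])
  show "\<delta> \<in> derivations" using \<delta> by (simp add: T_B_def)
  fix \<alpha> j \<mu> assume \<alpha>: "\<alpha> \<in> U" "lookup \<alpha> j > 0" and \<mu>: "\<mu> \<in> keys (\<delta> (var j))"
  show "\<alpha> - unit_exp j + \<mu> \<in> U"
  proof (cases "lookup \<mu> j > 0")
    case True
    have "\<alpha> - unit_exp j + \<mu> = (\<alpha> - unit_exp j + unit_exp j) + (\<mu> - unit_exp j)"
      using exp_remove_add[OF True] by (metis add.assoc add.commute)
    also have "\<dots> = \<alpha> + (\<mu> - unit_exp j)" using \<alpha>(2) by simp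
    finally show ?thesis using U \<alpha>(1) upsetD by (metis admissible_def)
  next
    case False
    then show ?thesis using admissible_shift[OF U T_B_exponent[OF \<delta> \<mu>] \<alpha>] by simp
  qed
qed

lemma keys_partial: "\<gamma> \<in> keys (partial j f) \<Longrightarrow> \<gamma> + unit_exp j \<in> keys f"
  by (auto simp: in_keys_iff lookup_partial)

lemma partial_in_T_B:
  assumes "j \<notin> active" shows "(partial j :: ('n, 'k::field) mpoly \<Rightarrow> _) \<in> T_B (mspan E)"
proof -
  have "partial j f \<in> mspan E" if "f \<in> mspan E" for f :: "('n, 'k) mpoly"
    unfolding mspan_def
  proof (intro CollectI subsetI)
    fix \<gamma> assume "\<gamma> \<in> keys (partial j f)"
    then have "\<gamma> + unit_exp j \<in> E" using keys_partial that by (auto simp: mspan_def)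
    from E_remove[OF this assms] show "\<gamma> \<in> E" by (simp add: lookup_add exp_add_remove)
  qed
  then show ?thesis by (auto simp: T_B_def partial_derivation)
qed

lemma var_partial_in_T_B:
  assumes "replaceable j l" shows "(\<lambda>f :: ('n, 'k::field) mpoly. var l * partial j f) \<in> T_B (mspan E)"
proof -
  have "var l * partial j f \<in> mspan E" if "f \<in> mspan E" for f :: "('n, 'k) mpoly"
    unfolding mspan_def
  proof (intro CollectI subsetI)
    fix \<gamma> assume "\<gamma> \<in> keys (var l * partial j f)"
    then obtain \<beta> where \<beta>: "\<gamma> = unit_exp l + \<beta>" "\<beta> \<in> keys (partial j f)"
      using keys_xmono_mult unfolding var_def by blast
    then have "\<beta> + unit_exp j \<in> E" using keys_partial that by (auto simp: mspan_def)
    from E_replace[OF this assms] show "\<gamma> \<in> E" by (simp add: lookup_add exp_add_remove \<beta>(1) add.commute)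
  qed
  then show ?thesis by (auto simp: T_B_def intro: partial_derivation derivations_mult)
qed

lemma N_set_eq: "N_set (mspan E :: ('n, 'k::field_char_0) mpoly set) = active"
proof -
  have "j \<notin> active" if "(partial j :: ('n, 'k) mpoly \<Rightarrow> _) \<in> T_B (mspan E)" for j
  proof
    assume "j \<in> active"
    then obtain \<beta> where \<beta>: "\<beta> \<in> E" "lookup \<beta> j > 0" "\<beta> - unit_exp j \<notin> E" by (auto simp: active_def)
    have "partial j (xmono \<beta> :: ('n, 'k) mpoly) \<in> mspan E" using that \<beta>(1) by (auto simp: T_B_def)
    then show False using \<beta>(2,3) by (simp add: xmono_def partial_single mspan_def)
  qed
  then show ?thesis using partial_in_T_B by (auto simp: N_set_def)
qed

lemma J_m_eq: "J_m (mspan E :: ('n, 'k::field_char_0) mpoly set) = mspan (adeg_ge 1)"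
proof -
  have "var ` active = (xmono ` unit_exp ` active :: ('n, 'k) mpoly set)"
    by (simp add: image_image var_def)
  moreover have "{\<alpha> + \<beta> | \<alpha> \<beta>. \<alpha> \<in> unit_exp ` active} = adeg_ge 1"
  proof (intro equalityI subsetI)
    fix \<alpha> assume "\<alpha> \<in> adeg_ge 1"
    then have "\<exists>j\<in>active. lookup \<alpha> j > 0" by (auto simp: adeg_ge_def adeg_def intro: ccontr)
    then obtain j where "j \<in> active" "lookup \<alpha> j > 0" by blast
    then show "\<alpha> \<in> {\<alpha> + \<beta> | \<alpha> \<beta>. \<alpha> \<in> unit_exp ` active}"
      by (intro CollectI exI[of _ "unit_exp j"] exI[of _ "\<alpha> - unit_exp j"]) (simp add: add.commute)
  qed (auto simp: adeg_ge_def adeg_add adeg_unit)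
  ultimately show ?thesis unfolding J_m_def N_set_eq by (simp add: Idl_xmono)
qed

lemma ideal_pow_J_m: "ideal_pow B_ring (mspan (adeg_ge 1)) i = (mspan (adeg_ge i) :: ('n, 'k::field) mpoly set)"
proof (induction i)
  case 0
  show ?case by (simp add: adeg_ge_def mspan_def)
next
  case (Suc i)
  have "f \<in> mspan (adeg_ge (Suc i))" if "f \<in> ideal_prod B_ring (mspan (adeg_ge 1)) (mspan (adeg_ge i))"
    for f :: "('n, 'k) mpoly"
    using that
  proof (induction f rule: ideal_prod.induct)
    case (prod f g)
    have "f * g \<in> mspan (adeg_ge (Suc i))"
      by (rule mspan_mult[OF _ prod]) (auto simp: adeg_ge_def adeg_add)
    then show ?case by simp
  next
    case (sum f g)
    then show ?case by (simp add: mspan_add)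
  qed
  moreover have "f \<in> ideal_prod B_ring (mspan (adeg_ge 1)) (mspan (adeg_ge i))"
    if f: "f \<in> mspan (adeg_ge (Suc i))" for f :: "('n, 'k) mpoly"
  proof -
    let ?P = "ideal_prod B_ring (mspan (adeg_ge 1)) (mspan (adeg_ge i)) :: ('n, 'k) mpoly set"
    have single: "Poly_Mapping.single \<alpha> c \<in> ?P" if "\<alpha> \<in> adeg_ge (Suc i)" for \<alpha> c
    proof -
      have "\<exists>j\<in>active. lookup \<alpha> j > 0" using that by (auto simp: adeg_ge_def adeg_def intro: ccontr)
      then obtain j where j: "j \<in> active" "lookup \<alpha> j > 0" by blast
      have "Poly_Mapping.single (unit_exp j) c \<in> mspan (adeg_ge 1)"
        using j(1) by (simp add: mspan_def adeg_ge_def adeg_unit)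
      moreover have "xmono (\<alpha> - unit_exp j) \<in> mspan (adeg_ge i)"
        using that adeg_remove[OF j(2)] j(1) by (simp add: adeg_ge_def)
      ultimately have "Poly_Mapping.single (unit_exp j) c \<otimes>\<^bsub>B_ring\<^esub> xmono (\<alpha> - unit_exp j) \<in> ?P"
        by (rule ideal_prod.prod)
      then show ?thesis using j(2) by (simp add: xmono_def mult_single add.commute)
    qed
    have zero: "0 \<in> ?P" using ideal_prod.prod[OF mspan_0 mspan_0, of B_ring] by simp
    have "(\<Sum>\<alpha>\<in>A. Poly_Mapping.single \<alpha> (lookup f \<alpha>)) \<in> ?P" if "finite A" "A \<subseteq> adeg_ge (Suc i)" for A
      using that
    proof (induction A)
      case (insert \<alpha> A)
      then show ?case using ideal_prod.sum[OF single[of \<alpha> "lookup f \<alpha>"], of _ ] by simp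
    qed (simp add: zero)
    from this[of "keys f"] f show ?thesis by (simp add: mspan_def flip: mpoly_sum_single)
  qed
  ultimately show ?case using Suc.IH by auto
qed

text \<open>The eigenvalue of \<open>x\<^sub>j \<partial>\<^sub>j\<close> on \<open>x\<^sup>\<alpha>\<close> is \<open>\<alpha>\<^sub>j\<close>, and in characteristic \<open>0\<close> these eigenvalues separate monomials.\<close>

lemma torus_stable_monomial:
  fixes K :: "('n, 'k::field_char_0) mpoly set"
  assumes K: "ideal K B_ring" and st: "\<And>f j. f \<in> K \<Longrightarrow> var j * partial j f \<in> K"
  shows "K = mspan {\<alpha>. xmono \<alpha> \<in> K}"
proof
  have "xmono \<beta> \<in> K" if "f \<in> K" "\<beta> \<in> keys f" for f \<beta>
    using that
  proof (induction "card (keys f)" arbitrary: f rule: less_induct)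
    case less
    show ?case
    proof (cases "keys f = {\<beta>}")
      case True
      have "f = Poly_Mapping.single \<beta> (lookup f \<beta>)" using mpoly_sum_single[of f] True by simp
      then have "const (inverse (lookup f \<beta>)) * f = xmono \<beta>"
        using less.prems(2) by (metis const_def xmono_def mult_single add_0 left_inverse in_keys_iff)
      then show ?thesis using K less.prems(1) unfolding ideal_B_ring_iff by metis
    next
      case False
      then obtain \<alpha> where \<alpha>: "\<alpha> \<in> keys f" "\<alpha> \<noteq> \<beta>" using less.prems(2) by auto
      then obtain j where j: "lookup \<alpha> j \<noteq> lookup \<beta> j" using poly_mapping_eqI[of \<alpha> \<beta>] by blast
      \<comment> \<open>Subtracting the eigenvalue of \<open>x\<^sup>\<alpha>\<close> removes that term and keeps the term of \<open>x\<^sup>\<beta>\<close>.\<close>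
      define g where "g = var j * partial j f + const (- of_nat (lookup \<alpha> j)) * f"
      have vp: "lookup (var j * partial j f) \<gamma> = of_nat (lookup \<gamma> j) * lookup f \<gamma>" for \<gamma>
      proof (cases "lookup \<gamma> j > 0")
        case True
        have "lookup (var j * partial j f) (unit_exp j + (\<gamma> - unit_exp j)) = lookup (partial j f) (\<gamma> - unit_exp j)"
          unfolding var_def by (rule lookup_xmono_mult_add)
        then have "lookup (var j * partial j f) \<gamma> = lookup (partial j f) (\<gamma> - unit_exp j)"
          using exp_remove_add[OF True] by (simp only: add.commute)
        then show ?thesis using True by (simp add: lookup_partial lookup_minus)
      next
        case False
        have "\<gamma> \<notin> keys (var j * partial j f)"
        proof
          assume "\<gamma> \<in> keys (var j * partial j f)"
          then obtain \<nu> where "\<gamma> = unit_exp j + \<nu>" using keys_xmono_mult unfolding var_def by blast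
          then show False using False by (simp add: lookup_add)
        qed
        then show ?thesis using False by (simp add: in_keys_iff)
      qed
      have g: "lookup g \<gamma> = (of_nat (lookup \<gamma> j) - of_nat (lookup \<alpha> j)) * lookup f \<gamma>" for \<gamma>
        by (simp add: g_def lookup_add vp lookup_const_mult ring_distribs)
      have "keys g \<subseteq> keys f - {\<alpha>}" by (auto simp: in_keys_iff g)
      then have "keys g \<subset> keys f" using \<alpha>(1) by auto
      then have "card (keys g) < card (keys f)" by (simp add: psubset_card_mono)
      moreover have "g \<in> K" using K st[OF less.prems(1)] less.prems(1) by (simp add: g_def ideal_B_ring_iff)
      moreover have "\<beta> \<in> keys g" using less.prems(2) j by (simp add: in_keys_iff g)
      ultimately show ?thesis by (rule less.hyps)
    qed
  qed
  then show "K \<subseteq> mspan {\<alpha>. xmono \<alpha> \<in> K}" by (auto simp: mspan_def)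
  show "mspan {\<alpha>. xmono \<alpha> \<in> K} \<subseteq> K" by (rule mspan_subset_ideal[OF K]) simp
qed

lemma T_B_stable_ideal:
  fixes K :: "('n, 'k::field_char_0) mpoly set"
  assumes K: "ideal K B_ring" and st: "\<And>\<delta> f. \<delta> \<in> T_B (mspan E) \<Longrightarrow> f \<in> K \<Longrightarrow> \<delta> f \<in> K"
    and bounds: "mspan (adeg_ge (Suc i) \<union> E) \<subseteq> K" "K \<subseteq> mspan (adeg_ge i \<union> E)"
  defines "U \<equiv> {\<alpha>. xmono \<alpha> \<in> K}"
  shows "K = mspan U" "admissible i U"
proof -
  show eq: "K = mspan U"
    unfolding U_def using st[OF var_partial_in_T_B[OF replaceable_refl]] by (rule torus_stable_monomial[OF K])
  have unit: "\<alpha> \<in> U" if "Poly_Mapping.single \<alpha> c \<in> K" "c \<noteq> 0" for \<alpha> c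
    using that unfolding eq by (simp add: mspan_def)
  have "upset U" using K by (simp add: upset_def U_def xmono_add ideal_B_ring_iff mult.commute)
  moreover have "adeg_ge (Suc i) \<union> E \<subseteq> U" "U \<subseteq> adeg_ge i \<union> E"
    using bounds unfolding eq by (simp_all only: mspan_subset_iff)
  moreover have "\<alpha> - unit_exp j \<in> U" if "\<alpha> \<in> U" "j \<notin> active" "lookup \<alpha> j > 0" for \<alpha> j
    using st[OF partial_in_T_B[OF that(2)], of "xmono \<alpha>"] that(1,3)
    by (intro unit[of _ "of_nat (lookup \<alpha> j)"]) (auto simp: U_def xmono_def partial_single)
  moreover have "\<alpha> - unit_exp j + unit_exp l \<in> U" if "\<alpha> \<in> U" "replaceable j l" "lookup \<alpha> j > 0" for \<alpha> j l
    using st[OF var_partial_in_T_B[OF that(2)], of "xmono \<alpha>"] that(1,3)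
    by (intro unit[of _ "of_nat (lookup \<alpha> j)"])
      (auto simp: U_def xmono_def var_def partial_single mult_single add.commute)
  ultimately show "admissible i U" unfolding admissible_def by blast
qed

end

section \<open>Submodules of the graded pieces\<close>

lemma UN_const: "A \<noteq> {} \<Longrightarrow> (\<And>x. x \<in> A \<Longrightarrow> F x = c) \<Longrightarrow> (\<Union>x\<in>A. F x) = c"
  by auto

text \<open>The \<open>i\<close>-th graded piece of \<open>B/I\<close>. Here \<open>J m\<close> is the power \<open>J\<^sup>m\<close> of the ideal \<open>J\<close> of active variables, and
\<open>L m\<close> is \<open>J\<^sup>m + I\<close>. The two layers of cosets are handled through the maps \<open>cosI\<close> from \<open>B\<close> to \<open>B/I\<close> and \<open>cl\<close>
from \<open>L i\<close> to the graded piece; the kernel of \<open>cl\<close> is \<open>L (Suc i)\<close>, and all operations of the graded piece are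
expressed on representatives.\<close>

locale graded_piece = monomial_upset E for E :: "('n::finite \<Rightarrow>\<^sub>0 nat) set" +
  fixes i :: nat and I :: "('n, 'k::field_char_0) mpoly set"
  assumes I_eq: "I = mspan E"
begin

abbreviation J :: "nat \<Rightarrow> ('n, 'k) mpoly set" where "J m \<equiv> mspan (adeg_ge m)"
abbreviation L :: "nat \<Rightarrow> ('n, 'k) mpoly set" where "L m \<equiv> mspan (adeg_ge m \<union> E)"

definition cosI :: "('n, 'k) mpoly \<Rightarrow> ('n, 'k) mpoly set" where
  "cosI f = I +>\<^bsub>B_ring\<^esub> f"

definition cl :: "('n, 'k) mpoly \<Rightarrow> ('n, 'k) mpoly set set" where
  "cl f = (\<lambda>h. cosI (h + f)) ` J (Suc i)"

lemma in_I: "f \<in> I \<longleftrightarrow> f \<in> mspan E"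
  by (simp add: I_eq)

lemma J_m_I: "J_m I = J 1"
  by (simp add: I_eq J_m_eq)

lemma I_nonempty: "I \<noteq> {}"
  by (simp add: I_eq mspan_nonempty)

lemma cl_nonempty: "cl f \<noteq> {}"
  by (simp add: cl_def mspan_nonempty)

lemma L_mono: "m \<le> m' \<Longrightarrow> L m' \<subseteq> L m"
  by (rule mspan_mono) (auto simp: adeg_ge_def)

lemma J_subset_L: "J m \<subseteq> L m" and I_subset_L: "I \<subseteq> L m"
  unfolding I_eq by (rule mspan_mono, simp)+

lemma ideal_I: "ideal I B_ring"
  unfolding I_eq by (rule ideal_mspan[OF up])

lemma cosI_image: "cosI f = (\<lambda>h. h + f) ` I"
  by (auto simp: cosI_def a_r_coset_def')

lemma cosI_eq_iff: "cosI f = cosI g \<longleftrightarrow> f - g \<in> I"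
proof
  assume "cosI f = cosI g"
  moreover have "f \<in> cosI f" unfolding cosI_image by (rule image_eqI[of _ _ 0]) (simp_all add: in_I mspan_0)
  ultimately obtain h where "h \<in> I" "f = h + g" by (auto simp: cosI_image)
  then show "f - g \<in> I" by simp
next
  assume fg: "f - g \<in> I"
  have sub: "cosI f \<subseteq> cosI g" if "f - g \<in> I" for f g
  proof
    fix x assume "x \<in> cosI f"
    then obtain h where "h \<in> I" "x = h + f" by (auto simp: cosI_image)
    then have "h + (f - g) \<in> I" "x = (h + (f - g)) + g" using that mspan_add by (auto simp: in_I)
    then show "x \<in> cosI g" unfolding cosI_image by blast
  qed
  have "g - f \<in> I" using fg mspan_diff[OF mspan_0 fg[unfolded in_I]] by (simp add: in_I)
  then show "cosI f = cosI g" using sub fg by blast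
qed

lemma S_carrier: "carrier (S_module I) = range cosI"
  by (auto simp: S_module_def Let_def FactRing_def A_RCOSETS_def' cosI_def)

lemma S_add: "cosI f \<oplus>\<^bsub>S_module I\<^esub> cosI g = cosI (f + g)"
proof -
  interpret ideal I "B_ring :: ('n, 'k) mpoly ring" by (rule ideal_I)
  show ?thesis using a_rcos_sum[of f g] by (simp add: S_module_def Let_def FactRing_def cosI_def)
qed

lemma S_smult: "a \<odot>\<^bsub>S_module I\<^esub> cosI f = cosI (a * f)"
proof -
  interpret ideal I "B_ring :: ('n, 'k) mpoly ring" by (rule ideal_I)
  show ?thesis using rcoset_mult_add[of a f] by (simp add: S_module_def Let_def FactRing_def cosI_def)
qed

lemma JS_eq: "JS I m = cosI ` J m"
proof (intro equalityI subsetI)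
  fix x assume "x \<in> JS I m"
  then have "x \<in> ideal_smult (S_module I) (J m)"
    unfolding JS_def I_eq J_m_eq ideal_pow_J_m .
  then show "x \<in> cosI ` J m"
  proof (induction x rule: ideal_smult.induct)
    case (smult a m')
    then obtain f where f: "m' = cosI f" by (auto simp: S_carrier)
    have "f * a \<in> J m" using smult(1) by (rule mspan_upset_mult[OF upset_adeg_ge])
    then show ?case by (auto simp: f S_smult mult.commute)
  next
    case (add x y)
    then show ?case by (auto simp: S_add intro!: imageI mspan_add)
  qed
next
  fix x assume "x \<in> cosI ` J m"
  then obtain f where "f \<in> J m" "x = cosI f" by blast
  moreover have "cosI 1 \<in> carrier (S_module I)" by (simp add: S_carrier)
  ultimately have "f \<odot>\<^bsub>S_module I\<^esub> cosI 1 \<in> ideal_smult (S_module I) (J m)"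
    by (intro ideal_smult.smult)
  then show "x \<in> JS I m" unfolding JS_def I_eq J_m_eq ideal_pow_J_m
    using \<open>x = cosI f\<close> by (simp add: S_smult flip: I_eq)
qed

text \<open>Hence \<open>cl f\<close> is the class, modulo \<open>J\<^sup>i\<^sup>+\<^sup>1 S\<close>, of the coset of \<open>f\<close> in \<open>S = B/I\<close>.\<close>

lemma cl_coset: "JS I (Suc i) +>\<^bsub>S_module I\<^esub> cosI f = cl f"
  by (auto simp: a_r_coset_def' JS_eq S_add cl_def)

lemma cl_eq_iff: "cl f = cl g \<longleftrightarrow> f - g \<in> L (Suc i)"
proof
  assume "cl f = cl g"
  moreover have "cosI (0 + f) \<in> cl f" unfolding cl_def by (intro imageI mspan_0)
  ultimately obtain h where h: "h \<in> J (Suc i)" "cosI f = cosI (h + g)" by (auto simp: cl_def)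
  then have "f - (h + g) \<in> L (Suc i)" "h \<in> L (Suc i)"
    using I_subset_L J_subset_L by (auto simp: cosI_eq_iff)
  from mspan_add[OF this] show "f - g \<in> L (Suc i)" by simp
next
  assume fg: "f - g \<in> L (Suc i)"
  have sub: "cl f \<subseteq> cl g" if fg': "f - g \<in> L (Suc i)" for f g
  proof
    fix x assume "x \<in> cl f"
    then obtain h where h: "h \<in> J (Suc i)" "x = cosI (h + f)" by (auto simp: cl_def)
    obtain u v where uv: "f - g = u + v" "u \<in> J (Suc i)" "v \<in> I"
      using mspan_decompose[OF fg'] unfolding I_eq by blast
    have "h + f - (h + u + g) = v" using uv(1) by (simp add: algebra_simps)
    then have "x = cosI ((h + u) + g)" using uv(3) by (simp add: h(2) cosI_eq_iff)
    then show "x \<in> cl g" unfolding cl_def using mspan_add[OF h(1) uv(2)] by blast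
  qed
  have "g - f \<in> L (Suc i)" using mspan_diff[OF mspan_0 fg] by simp
  then show "cl f = cl g" using sub fg by blast
qed

lemma G_carrier: "carrier (G_module I i) = cl ` L i"
proof -
  have "carrier (G_module I i) = cl ` J i"
    by (auto simp: G_module_def quot_module_def A_RCOSETS_def' JS_eq simp flip: cl_coset
        simp: a_r_coset_def')
  also have "\<dots> = cl ` L i"
  proof
    show "cl ` J i \<subseteq> cl ` L i" by (rule image_mono[OF J_subset_L])
    show "cl ` L i \<subseteq> cl ` J i"
    proof
      fix x assume "x \<in> cl ` L i"
      then obtain f where f: "f \<in> L i" "x = cl f" by blast
      obtain u v where uv: "f = u + v" "u \<in> J i" "v \<in> I"
        using mspan_decompose[OF f(1)] unfolding I_eq by blast
      have "f - u \<in> L (Suc i)" using uv I_subset_L by auto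
      then have "x = cl u" using f(2) by (simp add: cl_eq_iff)
      then show "x \<in> cl ` J i" using uv(2) by blast
    qed
  qed
  finally show ?thesis .
qed

lemma G_zero: "\<zero>\<^bsub>G_module I i\<^esub> = cl 0"
  by (simp add: G_module_def quot_module_def JS_eq cl_def)

lemma G_add: "cl f \<oplus>\<^bsub>G_module I i\<^esub> cl g = cl (f + g)"
proof -
  have "cl f \<oplus>\<^bsub>G_module I i\<^esub> cl g = (\<Union>h\<in>J (Suc i). \<Union>h'\<in>J (Suc i). {cosI (h + f + (h' + g))})"
    by (auto simp: G_module_def quot_module_def set_add_def' cl_def S_add)
  also have "\<dots> = cl (f + g)"
  proof (intro equalityI subsetI)
    fix x assume "x \<in> cl (f + g)"
    then obtain h where "h \<in> J (Suc i)" "x = cosI (h + (f + g))" by (auto simp: cl_def)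
    then show "x \<in> (\<Union>h\<in>J (Suc i). \<Union>h'\<in>J (Suc i). {cosI (h + f + (h' + g))})"
      by (intro UN_I[of h] UN_I[of 0]) (simp_all add: mspan_0 add.assoc)
  next
    fix x assume "x \<in> (\<Union>h\<in>J (Suc i). \<Union>h'\<in>J (Suc i). {cosI (h + f + (h' + g))})"
    then obtain h h' where "h \<in> J (Suc i)" "h' \<in> J (Suc i)" "x = cosI (h + f + (h' + g))" by blast
    moreover have "h + f + (h' + g) = (h + h') + (f + g)" by (simp add: algebra_simps)
    ultimately show "x \<in> cl (f + g)" unfolding cl_def by (auto intro: mspan_add)
  qed
  finally show ?thesis .
qed

lemma R_carrier: "carrier (R_ring I) = (\<lambda>a. J_m I +>\<^bsub>B_ring\<^esub> a) ` UNIV"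
  by (auto simp: R_ring_def FactRing_def A_RCOSETS_def')

lemma J_L_mult:
  assumes "b \<in> J 1" "f \<in> L i" shows "b * f \<in> L (Suc i)"
proof (rule mspan_mult[OF _ assms])
  fix \<alpha> \<beta> assume "\<alpha> \<in> adeg_ge 1" "\<beta> \<in> adeg_ge i \<union> E"
  then show "\<alpha> + \<beta> \<in> adeg_ge (Suc i) \<union> E"
    using upsetD[OF up, of \<beta> \<alpha>] by (auto simp: adeg_ge_def adeg_add add.commute[of \<alpha>])
qed

lemma upset_L: "upset (adeg_ge m \<union> E)"
  using upset_adeg_ge[of m] up by (auto simp: upset_def)

lemma G_smult:
  assumes f: "f \<in> L i"
  shows "(J_m I +>\<^bsub>B_ring\<^esub> a) \<odot>\<^bsub>G_module I i\<^esub> cl f = cl (a * f)"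
proof -
  have "(\<Union>b\<in>J_m I +>\<^bsub>B_ring\<^esub> a. \<Union>m\<in>cl f. JS I (Suc i) +>\<^bsub>S_module I\<^esub> (b \<odot>\<^bsub>S_module I\<^esub> m)) = cl (a * f)"
  proof (intro UN_const)
    show "J_m I +>\<^bsub>B_ring\<^esub> a \<noteq> {}" "cl f \<noteq> {}"
      by (simp_all add: a_r_coset_def' J_m_I mspan_nonempty cl_nonempty)
    fix b m assume "b \<in> J_m I +>\<^bsub>B_ring\<^esub> a" "m \<in> cl f"
    then obtain c h where c: "c \<in> J 1" "b = c + a" and h: "h \<in> J (Suc i)" "m = cosI (h + f)"
      by (auto simp: a_r_coset_def' J_m_I cl_def)
    have "b * (h + f) - a * f = b * h + c * f" by (simp add: c(2) algebra_simps)
    moreover have "\<dots> \<in> L (Suc i)"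
      by (intro mspan_add J_L_mult[OF c(1) f] mspan_upset_mult[OF upset_L] subsetD[OF J_subset_L] h(1))
    ultimately show "JS I (Suc i) +>\<^bsub>S_module I\<^esub> (b \<odot>\<^bsub>S_module I\<^esub> m) = cl (a * f)"
      by (simp add: h(2) S_smult cl_coset cl_eq_iff)
  qed
  then show ?thesis by (simp add: G_module_def quot_module_def a_r_coset_def')
qed

lemma T_B_stable_L: "\<delta> \<in> T_B I \<Longrightarrow> f \<in> L (Suc i) \<Longrightarrow> \<delta> f \<in> L (Suc i)"
  and T_B_stable_L': "\<delta> \<in> T_B I \<Longrightarrow> f \<in> L i \<Longrightarrow> \<delta> f \<in> L i"
  using admissible_T_B_stable[OF admissible_adeg_ge[of "Suc i" i]]
    admissible_T_B_stable[OF admissible_adeg_ge[of i i]] by (auto simp: I_eq)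

lemma act_S_cosI:
  assumes "\<delta> \<in> T_B I" shows "act_S I \<delta> (cosI f) = cosI (\<delta> f)"
  unfolding act_S_def
proof (rule UN_const)
  show "cosI f \<noteq> {}" by (simp add: cosI_image I_nonempty)
  fix g assume "g \<in> cosI f"
  then obtain h where h: "h \<in> I" "g = h + f" by (auto simp: cosI_image)
  have "\<delta> g = \<delta> h + \<delta> f" using assms by (simp add: T_B_def derivation_add h)
  moreover have "\<delta> h \<in> I" using assms h by (auto simp: T_B_def)
  ultimately show "I +>\<^bsub>B_ring\<^esub> \<delta> g = cosI (\<delta> f)" by (simp add: cosI_eq_iff flip: cosI_def)
qed

lemma act_G_cl:
  assumes d: "\<delta> \<in> T_B I" shows "act_G I i \<delta> (cl f) = cl (\<delta> f)"
  unfolding act_G_def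
proof (rule UN_const)
  show "cl f \<noteq> {}" by (rule cl_nonempty)
  fix s assume "s \<in> cl f"
  then obtain h where h: "h \<in> J (Suc i)" "s = cosI (h + f)" by (auto simp: cl_def)
  have "\<delta> (h + f) = \<delta> h + \<delta> f" using d by (simp add: T_B_def derivation_add)
  then have "\<delta> (h + f) - \<delta> f \<in> L (Suc i)" using T_B_stable_L[OF d subsetD[OF J_subset_L h(1)]] by simp
  then show "JS I (Suc i) +>\<^bsub>S_module I\<^esub> act_S I \<delta> s = cl (\<delta> f)"
    by (simp add: h(2) act_S_cosI[OF d] cl_coset cl_eq_iff)
qed

lemma T_B_add: "\<delta> \<in> T_B I \<Longrightarrow> \<epsilon> \<in> T_B I \<Longrightarrow> (\<lambda>g. \<delta> g + \<epsilon> g) \<in> T_B I"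
  by (auto simp: T_B_def derivations_def I_eq ring_distribs intro!: mspan_add)

lemma T_B_smult: "\<delta> \<in> T_B I \<Longrightarrow> (\<lambda>g. a * \<delta> g) \<in> T_B I"
  by (auto simp: T_B_def I_eq intro!: mspan_upset_mult[OF up] derivations_mult)

text \<open>The derivations in \<open>J T\<^sub>B(I)\<close> act as zero on the graded piece, which makes the action of
\<open>T\<^sub>B(I) / J T\<^sub>B(I)\<close> well defined.\<close>

lemma J_T_B_apply:
  assumes "\<eta> \<in> ideal_smult (T_B_module I) (J_m I)"
  shows "\<eta> \<in> T_B I \<and> (\<forall>f\<in>L i. \<eta> f \<in> L (Suc i))"
  using assms
proof (induction \<eta> rule: ideal_smult.induct)
  case (smult a \<delta>)
  then have "\<delta> \<in> T_B I" "a \<in> J 1" by (auto simp: T_B_module_def I_eq J_m_eq)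
  then show ?case
    using T_B_smult[of \<delta> a] J_L_mult T_B_stable_L' by (auto simp: T_B_module_def)
next
  case (add \<delta> \<epsilon>)
  then show ?case using T_B_add[of \<delta> \<epsilon>] by (auto simp: T_B_module_def intro: mspan_add)
qed

lemma zero_T_B: "(\<lambda>g. 0) \<in> T_B I"
  by (auto simp: T_B_def derivations_def I_eq mspan_0)

text \<open>The class of a derivation in the Lie algebroid \<open>T\<^sub>B(I) / J T\<^sub>B(I)\<close>.\<close>

definition gcl :: "(('n, 'k) mpoly \<Rightarrow> ('n, 'k) mpoly) \<Rightarrow> (('n, 'k) mpoly \<Rightarrow> ('n, 'k) mpoly) set" where
  "gcl \<delta> = ideal_smult (T_B_module I) (J_m I) +>\<^bsub>T_B_module I\<^esub> \<delta>"

lemma g_R_carrier: "carrier (g_R I) = gcl ` T_B I"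
  by (auto simp: g_R_def quot_module_def A_RCOSETS_def' gcl_def T_B_module_def)

lemma act_g_R_cl:
  assumes d: "\<delta> \<in> T_B I" and f: "f \<in> L i"
  shows "act_g_R I i (gcl \<delta>) (cl f) = cl (\<delta> f)"
  unfolding act_g_R_def
proof (rule UN_const)
  have "0 \<in> J_m I" by (simp add: J_m_I mspan_0)
  then have "0 \<odot>\<^bsub>T_B_module I\<^esub> (\<lambda>g. 0) \<in> ideal_smult (T_B_module I) (J_m I)"
    by (rule ideal_smult.smult) (simp add: T_B_module_def zero_T_B)
  then show "gcl \<delta> \<noteq> {}" by (auto simp: gcl_def a_r_coset_def')
  fix \<epsilon> assume "\<epsilon> \<in> gcl \<delta>"
  then obtain \<eta> where \<eta>: "\<eta> \<in> ideal_smult (T_B_module I) (J_m I)" "\<epsilon> = (\<lambda>g. \<eta> g + \<delta> g)"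
    by (auto simp: gcl_def a_r_coset_def' T_B_module_def)
  have "\<epsilon> \<in> T_B I" using J_T_B_apply[OF \<eta>(1)] T_B_add d by (simp add: \<eta>(2))
  then have "act_G I i \<epsilon> (cl f) = cl (\<epsilon> f)" by (rule act_G_cl)
  also have "\<dots> = cl (\<delta> f)" using J_T_B_apply[OF \<eta>(1)] f by (simp add: \<eta>(2) cl_eq_iff)
  finally show "act_G I i \<epsilon> (cl f) = cl (\<delta> f)" .
qed

abbreviation stable :: "('n, 'k) mpoly set set set \<Rightarrow> bool" where
  "stable \<equiv> stable_submodule (R_ring I) (carrier (g_R I)) (act_g_R I i) (G_module I i)"

lemma admissible_bounds:
  assumes "admissible i U" shows "mspan U \<subseteq> L i" "L (Suc i) \<subseteq> mspan U"
  using assms by (auto simp: admissible_def intro!: mspan_mono)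

lemma cl_mem_image:
  assumes "admissible i U" shows "cl f \<in> cl ` mspan U \<longleftrightarrow> f \<in> mspan U"
proof
  assume "cl f \<in> cl ` mspan U"
  then obtain g where "g \<in> mspan U" "f - g \<in> L (Suc i)" by (auto simp: cl_eq_iff)
  then have "(f - g) + g \<in> mspan U" using admissible_bounds[OF assms] by (intro mspan_add) auto
  then show "f \<in> mspan U" by simp
qed simp

text \<open>The inverse of the additive group is defined by a description, so uniqueness is part of the proof.\<close>

lemma G_minus:
  assumes "f \<in> L i" shows "inv\<^bsub>add_monoid (G_module I i)\<^esub> (cl f) = cl (- f)"
proof -
  have neg: "- f \<in> L i" using mspan_diff[OF mspan_0 assms] by simp
  have "(THE y. y \<in> cl ` L i \<and> cl f \<oplus>\<^bsub>G_module I i\<^esub> y = cl 0 \<and> y \<oplus>\<^bsub>G_module I i\<^esub> cl f = cl 0) = cl (- f)"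
  proof (rule the_equality)
    fix y assume "y \<in> cl ` L i \<and> cl f \<oplus>\<^bsub>G_module I i\<^esub> y = cl 0 \<and> y \<oplus>\<^bsub>G_module I i\<^esub> cl f = cl 0"
    then obtain g where "y = cl g" "cl (g + f) = cl 0" by (auto simp: G_add)
    then show "y = cl (- f)" by (simp add: cl_eq_iff)
  qed (use neg in \<open>simp add: G_add\<close>)
  then show ?thesis by (simp add: m_inv_def G_carrier G_zero)
qed

lemma stable_image:
  assumes U: "admissible i U" shows "stable (cl ` mspan U)"
proof -
  note sub = subsetD[OF admissible_bounds(1)[OF U]]
  have uU: "upset U" using U by (simp add: admissible_def)
  have "subgroup (cl ` mspan U) (add_monoid (G_module I i))"
  proof
    show "cl ` mspan U \<subseteq> carrier (add_monoid (G_module I i))" using sub by (auto simp: G_carrier)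
    show "\<one>\<^bsub>add_monoid (G_module I i)\<^esub> \<in> cl ` mspan U" by (simp add: G_zero mspan_0)
    show "x \<otimes>\<^bsub>add_monoid (G_module I i)\<^esub> y \<in> cl ` mspan U" if "x \<in> cl ` mspan U" "y \<in> cl ` mspan U" for x y
      using that by (auto simp: G_add intro!: imageI mspan_add)
    show "inv\<^bsub>add_monoid (G_module I i)\<^esub> x \<in> cl ` mspan U" if x: "x \<in> cl ` mspan U" for x
    proof -
      obtain f where f: "f \<in> mspan U" "x = cl f" using x by blast
      have "- f \<in> mspan U" using mspan_diff[OF mspan_0 f(1)] by simp
      then show ?thesis using f sub by (simp add: G_minus)
    qed
  qed
  moreover have "r \<odot>\<^bsub>G_module I i\<^esub> x \<in> cl ` mspan U" if "r \<in> carrier (R_ring I)" "x \<in> cl ` mspan U" for r x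
    using that sub by (auto simp: R_carrier G_smult intro!: imageI mspan_upset_mult[OF uU])
  moreover have "act_g_R I i a x \<in> cl ` mspan U" if ax: "a \<in> carrier (g_R I)" "x \<in> cl ` mspan U" for a x
  proof -
    obtain \<delta> f where "a = gcl \<delta>" "\<delta> \<in> T_B I" "x = cl f" "f \<in> mspan U"
      using ax by (auto simp: g_R_carrier)
    then show ?thesis using sub admissible_T_B_stable[OF U, of \<delta> f] by (simp add: act_g_R_cl flip: I_eq)
  qed
  ultimately show ?thesis
    by (auto simp: stable_submodule_def submodule_def submodule_axioms_def)
qed

lemma stable_is_image:
  assumes H: "stable H" shows "\<exists>U. admissible i U \<and> H = cl ` mspan U"
proof -
  have sg: "subgroup H (add_monoid (G_module I i))"
    and sm: "\<And>r x. r \<in> carrier (R_ring I) \<Longrightarrow> x \<in> H \<Longrightarrow> r \<odot>\<^bsub>G_module I i\<^esub> x \<in> H"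
    and act: "\<And>a x. a \<in> carrier (g_R I) \<Longrightarrow> x \<in> H \<Longrightarrow> act_g_R I i a x \<in> H"
    using H by (auto simp: stable_submodule_def submodule_def submodule_axioms_def)
  have HG: "H \<subseteq> cl ` L i" using subgroup.subset[OF sg] by (simp add: G_carrier)
  have zero: "cl 0 \<in> H" using subgroup.one_closed[OF sg] by (simp add: G_zero)
  have add: "cl (f + g) \<in> H" if "cl f \<in> H" "cl g \<in> H" for f g
    using subgroup.m_closed[OF sg that] by (simp add: G_add)
  define K where "K = {f \<in> L i. cl f \<in> H}"
  have HK: "H = cl ` K" using HG by (auto simp: K_def)
  have "ideal K B_ring"
    unfolding ideal_B_ring_iff
  proof (intro conjI ballI allI)
    show "0 \<in> K" by (simp add: K_def mspan_0 zero)
    show "f + g \<in> K" if "f \<in> K" "g \<in> K" for f g using that by (simp add: K_def add mspan_add)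
    show "g * f \<in> K" if "f \<in> K" for f g
      using that sm[of "J_m I +>\<^bsub>B_ring\<^esub> g" "cl f"]
      by (auto simp: K_def R_carrier G_smult intro: mspan_upset_mult[OF upset_L])
  qed
  moreover have "\<delta> f \<in> K" if "\<delta> \<in> T_B (mspan E)" "f \<in> K" for \<delta> f
    using that act[of "gcl \<delta>" "cl f"] T_B_stable_L'[of \<delta> f]
    by (auto simp: K_def g_R_carrier act_g_R_cl simp flip: I_eq)
  moreover have "L (Suc i) \<subseteq> K"
  proof
    fix f assume f: "f \<in> L (Suc i)"
    have "f \<in> L i" using f L_mono[of i "Suc i"] by auto
    moreover have "cl f = cl 0" using f by (simp add: cl_eq_iff)
    ultimately show "f \<in> K" using zero by (simp add: K_def)
  qed
  moreover have "K \<subseteq> L i" by (auto simp: K_def)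
  ultimately show ?thesis using T_B_stable_ideal[of K i] HK by metis
qed

text \<open>The exponents of the monomials whose classes lie in \<open>H\<close>. Monomials in \<open>L (Suc i)\<close> have class zero and are
counted as well, so that \<open>exps\<close> inverts the passage from an admissible set to a stable submodule.\<close>

definition exps :: "('n, 'k) mpoly set set set \<Rightarrow> ('n \<Rightarrow>\<^sub>0 nat) set" where
  "exps H = {\<alpha>. cl (xmono \<alpha>) \<in> H}"

lemma exps_image: "admissible i U \<Longrightarrow> exps (cl ` mspan U) = U"
  by (simp add: exps_def cl_mem_image)

lemma cl_image_mono:
  assumes "admissible i U" "admissible i U'"
  shows "cl ` mspan U \<subseteq> cl ` mspan U' \<longleftrightarrow> U \<subseteq> U'"
proof
  assume "cl ` mspan U \<subseteq> cl ` mspan U'"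
  then have "exps (cl ` mspan U) \<subseteq> exps (cl ` mspan U')" unfolding exps_def by blast
  then show "U \<subseteq> U'" by (simp only: exps_image assms)
qed (rule image_mono[OF mspan_mono])

theorem Lie_length_eq:
  "Lie_length I i = enat (card {\<gamma>. keys \<gamma> \<subseteq> cls ` active \<and> tdeg \<gamma> = i \<and> \<gamma> \<notin> E})"
  unfolding Lie_length_def
proof (rule module_length_eq_card[where supp = "\<lambda>H. cdegs i (exps H)"])
  note top = admissible_adeg_ge[of i i, simplified] and bot = admissible_adeg_ge[of "Suc i" i, simplified]
  have zero: "{\<zero>\<^bsub>G_module I i\<^esub>} = cl ` L (Suc i)"
  proof -
    have "cl f = cl 0" if "f \<in> L (Suc i)" for f using that by (simp add: cl_eq_iff)
    then show ?thesis unfolding G_zero using mspan_0 by blast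
  qed
  show "stable {\<zero>\<^bsub>G_module I i\<^esub>}" "cdegs i (exps {\<zero>\<^bsub>G_module I i\<^esub>}) = {}"
    unfolding zero using stable_image[OF bot] by (simp_all add: exps_image[OF bot] cdegs_bot)
  show "stable (carrier (G_module I i))"
    "cdegs i (exps (carrier (G_module I i))) = {\<gamma>. keys \<gamma> \<subseteq> cls ` active \<and> tdeg \<gamma> = i \<and> \<gamma> \<notin> E}"
    unfolding G_carrier using stable_image[OF top] by (simp_all add: exps_image[OF top] cdegs_top)
  show "finite {\<gamma>. keys \<gamma> \<subseteq> cls ` active \<and> tdeg \<gamma> = i \<and> \<gamma> \<notin> E}"
    using finite_cdegs[OF top] unfolding cdegs_top .
next
  fix H H' assume H: "stable H" and H': "stable H'"
  obtain U U' where U: "admissible i U" "H = cl ` mspan U" "admissible i U'" "H' = cl ` mspan U'"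
    using stable_is_image[OF H] stable_is_image[OF H'] by metis
  then show "H \<subseteq> H' \<longleftrightarrow> cdegs i (exps H) \<subseteq> cdegs i (exps H')"
    unfolding U(2,4) exps_image[OF U(1)] exps_image[OF U(3)] cl_image_mono[OF U(1,3)]
    by (intro cdegs_mono U)
  assume "H \<subset> H'"
  then have "U \<subset> U'" using cl_image_mono[OF U(1,3)] U(2,4) by blast
  from admissible_step[OF U(1,3) this] obtain U'' \<gamma> where
    step: "admissible i U''" "\<gamma> \<notin> cdegs i U" "cdegs i U'' = insert \<gamma> (cdegs i U)" "U'' \<subseteq> U'" by blast
  then show "\<exists>H'' x. stable H'' \<and> x \<notin> cdegs i (exps H) \<and>
      cdegs i (exps H'') = insert x (cdegs i (exps H)) \<and> cdegs i (exps H'') \<subseteq> cdegs i (exps H')"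
    unfolding U(2,4) exps_image[OF U(1)] exps_image[OF U(3)]
    using step cdegs_mono[OF step(1) U(3)] stable_image[OF step(1)]
    by (intro exI[of _ "cl ` mspan U''"] exI[of _ \<gamma>]) (simp only: exps_image[OF step(1)] simp_thms)
qed

end

section \<open>Rationality of the Hilbert series\<close>

theorem proposition4p7:
  fixes I :: "('n::finite, 'k::{alg_closed_field, field_char_0}) mpoly set"
  assumes "monomial_ideal I"
  shows "(\<forall>i. Lie_length I i \<noteq> \<infinity>) \<and> rational_fps (H_Lie I)"
proof -
  obtain A :: "('n \<Rightarrow>\<^sub>0 nat) set" where A: "I = Idl\<^bsub>B_ring\<^esub> (xmono ` A)"
    using assms by (auto simp: monomial_ideal_def)
  define E where "E = {\<alpha> + \<beta> | \<alpha> \<beta>. \<alpha> \<in> A}"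
  have I: "I = mspan E" by (simp add: A E_def Idl_xmono)
  have up: "upset E" unfolding E_def upset_def by (force simp: add.assoc)
  interpret monomial_upset E by unfold_locales (rule up)
  have len: "Lie_length I i = enat (card {\<gamma>. keys \<gamma> \<subseteq> cls ` active \<and> tdeg \<gamma> = i \<and> \<gamma> \<notin> E})" for i
  proof -
    interpret graded_piece E i I by unfold_locales (rule I)
    show ?thesis by (rule Lie_length_eq)
  qed
  have "H_Lie I = complement_series (cls ` active) E"
    by (simp add: H_Lie_def len complement_series_def)
  then show ?thesis using rational_complement_series[OF _ up, of "cls ` active"] len by simp
qed

end
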